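(* Let $K\subset\mathbb{R}^n$ be a nonempty closed convex set, let $P:\mathbb{R}^n\to\mathbb{R}^n$ be a polynomial map of degree $d$, where $d$ is a positive integer, and let $\mathcal{S}:=\mathrm{SOL}(K^\infty,P^\infty)$. Assume that $K$ is semi-algebraic, $0\in K$, and $P$ is copositive on $K$. Let $p\in\mathrm{int}(\mathcal{S}^* )$ be given. Then there exist constants $\varepsilon>0$, $L>0$ and $c>0$ with the following property: if $Q\in\mathcal{P}_d$, $Q$ is copositive on $K$, and $q\in\mathbb{R}^n$ satisfy $$\max\{\|Q-P\|,\|q-p\|\}<\varepsilon,$$ then $\mathrm{SOL}(K,Q+q)$ is nonempty and bounded, and $$\mathrm{SOL}(K,Q+q)\subset\mathrm{SOL}(K,P+p)+L\left(\|Q-P\|+\|q-p\|\right)^c\,\mathbb{B}(0,1),$$ where $\mathbb{B}(0,1)$ is the closed unit ball in $\mathbb{R}^n$.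
   Context: For a nonempty closed convex set $K\subset\mathbb{R}^n$ and a continuous map $F:\mathbb{R}^n\to\mathbb{R}^n$, $\mathrm{SOL}(K,F)$ denotes the set of $x\in K$ such that $\langle F(x),y-x\rangle\ge 0$ for all $y\in K$. For $q\in\mathbb{R}^n$, $Q+q$ denotes the map $x\mapsto Q(x)+q$. The asymptotic cone of $K$ is $K^\infty=\{v\in\mathbb{R}^n:\exists t_k\to\infty,\ \exists x_k\in K,\ x_k/t_k\to v\}$ (the recession cone of $K$). For a polynomial map $P=(P_1,\dots,P_n)$, its degree is $d=\max_l\deg P_l$, and $P^\infty=(P_1^\infty,\dots,P_n^\infty)$, where $P_l^\infty$ is the homogeneous component of degree $d$ of $P_l$. $\mathcal{P}_d$ is the finite-dimensional vector space of polynomial maps $\mathbb{R}^n\to\mathbb{R}^n$ all of whose components have degree at most $d$; $\|Q\|$ is the Frobenius norm of the matrix of coefficients of $Q$. A map $F$ is copositive on $K$ if $\langle F(x),x\rangle\ge 0$ for all $x\in K$. For a cone $C\subset\mathbb{R}^n$ (not necessarily convex), $C^*=\{q\in\mathbb{R}^n:\langle q,v\rangle\ge 0\ \forall v\in C\}$ and $\mathrm{int}$ denotes interior. A subset of $\mathbb{R}^n$ is semi-algebraic if it is a finite union of sets each defined by finitely many polynomial equations and strict polynomial inequalities. *)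

theory Defs
  imports "HOL-Analysis.Analysis" "HOL-Library.Poly_Mapping"
begin

subsection \<open>Polynomials and polynomial maps in the variables indexed by a finite type\<close>

type_synonym 'n monom = "'n \<Rightarrow>\<^sub>0 nat"

type_synonym 'n rpoly = "'n monom \<Rightarrow>\<^sub>0 real"

text \<open>A polynomial map is the vector of its component polynomials (not merely the induced
  function), so that degrees, homogeneous components and coefficient norms can be read off.\<close>

type_synonym 'n poly_map = "('n rpoly) ^ 'n"

definition monom_degree :: "('n::finite) monom \<Rightarrow> nat" where
  "monom_degree m = (\<Sum>i\<in>UNIV. Poly_Mapping.lookup m i)"

definition monom_value :: "('n::finite) monom \<Rightarrow> real ^ 'n \<Rightarrow> real" where
  "monom_value m x = (\<Prod>i\<in>UNIV. (x $ i) ^ Poly_Mapping.lookup m i)"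

definition poly_value :: "('n::finite) rpoly \<Rightarrow> real ^ 'n \<Rightarrow> real" where
  "poly_value p x = (\<Sum>m\<in>Poly_Mapping.keys p. Poly_Mapping.lookup p m * monom_value m x)"

text \<open>The zero polynomial gets degree 0.\<close>

definition poly_degree :: "('n::finite) rpoly \<Rightarrow> nat" where
  "poly_degree p = Max (insert 0 (monom_degree ` Poly_Mapping.keys p))"

definition homogeneous_component :: "nat \<Rightarrow> ('n::finite) rpoly \<Rightarrow> 'n rpoly" where
  "homogeneous_component d p =
     (\<Sum>m\<in>{m \<in> Poly_Mapping.keys p. monom_degree m = d}.
        Poly_Mapping.single m (Poly_Mapping.lookup p m))"

definition poly_map_value :: "('n::finite) poly_map \<Rightarrow> real ^ 'n \<Rightarrow> real ^ 'n" where
  "poly_map_value P x = (\<chi> l. poly_value (P $ l) x)"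

definition poly_map_degree :: "('n::finite) poly_map \<Rightarrow> nat" where
  "poly_map_degree P = Max (range (\<lambda>l. poly_degree (P $ l)))"

text \<open>Every component is truncated at the degree of the whole map, so a component of smaller
  degree contributes the zero polynomial.\<close>

definition leading_part :: "('n::finite) poly_map \<Rightarrow> 'n poly_map" where
  "leading_part P = (\<chi> l. homogeneous_component (poly_map_degree P) (P $ l))"

definition poly_maps_upto :: "nat \<Rightarrow> ('n::finite) poly_map set" where
  "poly_maps_upto d = {Q. \<forall>l. poly_degree (Q $ l) \<le> d}"

text \<open>The Frobenius norm of the coefficient matrix; coefficients outside
  \<open>keys\<close> vanish.\<close>

definition coeff_norm :: "('n::finite) poly_map \<Rightarrow> real" where
  "coeff_norm Q =
     sqrt (\<Sum>l\<in>UNIV. \<Sum>m\<in>Poly_Mapping.keys (Q $ l). (Poly_Mapping.lookup (Q $ l) m)\<^sup>2)"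

subsection \<open>Semi-algebraic sets\<close>

definition basic_semialgebraic :: "(real ^ 'n::finite) set \<Rightarrow> bool" where
  "basic_semialgebraic S \<longleftrightarrow>
     (\<exists>E G. finite E \<and> finite G \<and>
        S = {x. (\<forall>p\<in>E. poly_value p x = 0) \<and> (\<forall>p\<in>G. poly_value p x > 0)})"

definition semialgebraic :: "(real ^ 'n::finite) set \<Rightarrow> bool" where
  "semialgebraic S \<longleftrightarrow>
     (\<exists>\<F>. finite \<F> \<and> (\<forall>T\<in>\<F>. basic_semialgebraic T) \<and> S = \<Union>\<F>)"

subsection \<open>Variational inequalities\<close>

definition SOL :: "'a::real_inner set \<Rightarrow> ('a \<Rightarrow> 'a) \<Rightarrow> 'a set" where
  "SOL K F = {x \<in> K. \<forall>y\<in>K. F x \<bullet> (y - x) \<ge> 0}"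

definition asymptotic_cone :: "'a::real_normed_vector set \<Rightarrow> 'a set" where
  "asymptotic_cone K =
     {v. \<exists>(t :: nat \<Rightarrow> real) x. filterlim t at_top sequentially \<and> (\<forall>k. x k \<in> K) \<and>
           (\<lambda>k. x k /\<^sub>R t k) \<longlonglongrightarrow> v}"

definition copositive_on :: "'a::real_inner set \<Rightarrow> ('a \<Rightarrow> 'a) \<Rightarrow> bool" where
  "copositive_on K F \<longleftrightarrow> (\<forall>x\<in>K. F x \<bullet> x \<ge> 0)"

definition dual_cone :: "'a::real_inner set \<Rightarrow> 'a set" where
  "dual_cone C = {q. \<forall>v\<in>C. q \<bullet> v \<ge> 0}"

end

theory Submission
  imports Defs
begin

text \<open>
  Write F = P + p, and let S be the solution set for the asymptotic cone of K and the leading part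
  of P.

  Existence and boundedness rest on one compactness argument (lemma SOL_uniformly_bounded). Suppose
  perturbed problems (Q_k, q_k) tending to (P, p), posed on K or on K cut with a ball, had
  solutions x_k with norms r_k tending to infinity, and let v be a limit of the directions x_k / r_k.
  Only leading terms survive after division by a power of r_k. Comparing x_k with the points r_k w
  of K, for w in the asymptotic cone, therefore shows that v lies in S. Comparing x_k with 0 and using
  copositivity gives q_k . x_k \<le> 0, hence p . v \<le> 0 in the limit, which contradicts
  p being interior to the dual cone of S. With a bound R that is uniform over the perturbations,
  the Brouwer fixed point theorem on K cut with the ball of radius R + 1 yields a solution that
  stays off the boundary of the ball and hence solves the problem on all of K.

  For the Hoelder estimate, a solution x of a perturbed problem satisfies
  F x . (y - x) + t (1 + |y - x|^2) \<ge> 0 for all y in K, where t is a constant times the size of the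
  perturbation. Consider the planar set of pairs (t, s) such that some such x in the ball of radius
  R has squared distance at least s from every solution for F in that ball. By compactness its
  slices over t shrink to s \<le> 0 as t tends to 0. The set is defined by a first-order formula over the
  reals, so by quantifier elimination membership depends only on the signs of finitely many
  polynomials in (t, s). The supremum of a slice is then a zero of one of these polynomials f, and
  f(t, .) is not the zero polynomial.
  Write f(t, s) = t^k (s^m u(s) + t B(t, s)) with u(0) nonzero: a zero close to the
  origin satisfies s^m \<le> C t. This is the source of the exponent c
  (lemmas zeros_of_bivariate_poly_Hoelder, sign_determined_slices_Hoelder, approx_SOL_Hoelder).

  Quantifier elimination is needed only in a form without normal forms: a set is sign_determined if
  membership in it depends only on the signs of finitely many polynomial functions. The heart is the
  closure of this notion under projection along a line. It follows once the signs of finitely many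
  functions of the parameters are known to determine the signs of given polynomials along the line,
  up to an increasing bijection of the line (lemma sign_match_from_coefficients). The
  induction goes back to Cohen and Hoermander: a polynomial p of highest degree is traded for its
  derivative and for polynomials of lower degree that have the sign of p at the zeros of the
  others. Between two consecutive such zeros p is strictly monotone, so its zeros can be
  inserted into an existing arrangement (lemma sign_match_insert).
\<close>

section \<open>Moving the zeros of a univariate polynomial\<close>

text \<open>The first components of the pairs live on a line with coordinate \<open>t\<close>, the second
  ones on another copy of the line; \<open>h\<close> identifies the two copies in such a way that the
  signs agree everywhere. The number and the order of the zeros are then the same on both sides.\<close>

definition sign_match :: "(real \<Rightarrow> real) \<Rightarrow> (real poly \<times> real poly) set \<Rightarrow> bool" where
  "sign_match h Q \<longleftrightarrow> strict_mono h \<and> surj h \<and>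
     (\<forall>(q, q')\<in>Q. \<forall>t. sgn (poly q t) = sgn (poly q' (h t)))"

text \<open>A piecewise linear map with a single break inside the interval does this. It is the tool for
  correcting an identification of two lines at one point without disturbing it elsewhere.\<close>

lemma move_point:
  fixes a b c c' :: real
  assumes "a < c" "c < b" "a < c'" "c' < b"
  obtains g where "strict_mono g" "surj g" "g c = c'" "\<And>s. s \<le> a \<or> b \<le> s \<Longrightarrow> g s = s"
proof -
  define u where "u = (c' - a) / (c - a)"
  define v where "v = (b - c') / (b - c)"
  have uv: "u > 0" "v > 0" using assms by (auto simp: u_def v_def)
  define g where "g = (\<lambda>s. if s \<le> a \<or> b \<le> s then s else
     if s \<le> c then a + (s - a) * u else b - (b - s) * v)"
  have uc: "(c - a) * u = c' - a" and vc: "(b - c) * v = b - c'"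
    using assms by (auto simp: u_def v_def)
  have left: "a < a + (s - a) * u" "a + (s - a) * u \<le> c'" if "a < s" "s \<le> c" for s
  proof -
    show "a < a + (s - a) * u" using that uv by simp
    have "(s - a) * u \<le> (c - a) * u" using that uv by (intro mult_right_mono) auto
    then show "a + (s - a) * u \<le> c'" using uc by simp
  qed
  have right: "b - (b - s) * v < b" "c' < b - (b - s) * v" if "c < s" "s < b" for s
  proof -
    show "b - (b - s) * v < b" using that uv by simp
    have "(b - s) * v < (b - c) * v" using that uv by (intro mult_strict_right_mono) auto
    then show "c' < b - (b - s) * v" using vc by simp
  qed
  have "g s < g t" if st: "s < t" for s t
  proof -
    have 1: "(s - a) * u < (t - a) * u" "(b - t) * v < (b - s) * v"
      using st uv by (auto intro!: mult_strict_right_mono)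
    show ?thesis
      using st 1 left[of s] left[of t] right[of s] right[of t] assms
      unfolding g_def by (auto split: if_splits)
  qed
  then have "strict_mono g" by (simp add: strict_mono_def)
  moreover have "surj g"
  proof (rule surjI)
    fix y
    have l: "a < a + (y - a) / u \<and> a + (y - a) / u \<le> c" if "a < y" "y \<le> c'"
    proof -
      have "(y - a) / u \<le> (c' - a) / u" using that uv by (intro divide_right_mono) auto
      also have "\<dots> = c - a" using uc uv by (simp add: field_simps)
      finally show ?thesis using that uv by simp
    qed
    have r: "c < b - (b - y) / v \<and> b - (b - y) / v < b" if "c' < y" "y < b"
    proof -
      have "(b - y) / v < (b - c') / v" using that uv by (intro divide_strict_right_mono) auto
      also have "\<dots> = b - c" using vc uv by (simp add: field_simps)
      finally show ?thesis using that uv by simp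
    qed
    show "g ((\<lambda>y. if y \<le> a \<or> b \<le> y then y else
     if y \<le> c' then a + (y - a) / u else b - (b - y) / v) y) = y"
      using l r uv assms unfolding g_def by (auto simp: divide_le_0_iff split: if_splits)
  qed
  moreover have "g c = c'" using assms uc by (simp add: g_def)
  ultimately show ?thesis by (rule that) (auto simp: g_def)
qed

lemma neighbours_in_finite_set:
  fixes Z :: "real set"
  assumes "finite Z" "t \<notin> Z" "t0 \<in> Z" "t0 < t" "t1 \<in> Z" "t < t1"
  obtains \<alpha> \<beta> where "\<alpha> \<in> Z" "\<beta> \<in> Z" "\<alpha> < t" "t < \<beta>" "\<And>z. z \<in> Z \<Longrightarrow> z \<le> \<alpha> \<or> \<beta> \<le> z"
proof -
  let ?A = "{z\<in>Z. z < t}" and ?B = "{z\<in>Z. t < z}"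
  have f: "finite ?A" "finite ?B" "?A \<noteq> {}" "?B \<noteq> {}" using assms by auto
  have "Max ?A \<in> ?A" "Min ?B \<in> ?B" using f Max_in Min_in by blast+
  moreover have "z \<le> Max ?A \<or> Min ?B \<le> z" if "z \<in> Z" for z
  proof (cases "z < t")
    case True then show ?thesis using f that by auto
  next
    case False
    then have "t < z" using that assms(2) by (metis linorder_neqE_linordered_idom)
    then show ?thesis using f that by auto
  qed
  ultimately show ?thesis using that[of "Max ?A" "Min ?B"] by auto
qed

lemma sgn_poly_constant:
  fixes p :: "real poly"
  assumes "\<And>u. min s t \<le> u \<Longrightarrow> u \<le> max s t \<Longrightarrow> poly p u \<noteq> 0"
  shows "sgn (poly p s) = sgn (poly p t)"
proof (rule ccontr)
  assume ne: "sgn (poly p s) \<noteq> sgn (poly p t)"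
  have nz: "poly p s \<noteq> 0" "poly p t \<noteq> 0" using assms[of s] assms[of t] by auto
  have "poly p s * poly p t < 0" using ne nz
    by (auto simp: sgn_if mult_less_0_iff split: if_splits)
  then have "\<exists>u>min s t. u < max s t \<and> poly p u = 0"
    using poly_IVT[of s t p] poly_IVT[of t s p] by (cases s t rule: linorder_cases)
      (auto simp: mult.commute min_def max_def)
  then show False using assms by force
qed

text \<open>By the mean value theorem \<open>p\<close> is strictly monotone on the interval, so it changes sign at \<open>r\<close>.\<close>

lemma poly_sign_change:
  fixes p :: "real poly"
  assumes "a < r" "r < b" "poly p r = 0"
    and nz: "\<And>u. a < u \<Longrightarrow> u < b \<Longrightarrow> poly (pderiv p) u \<noteq> 0"
  shows "poly p a * poly p b < 0"
proof -
  obtain x where x: "a < x" "x < r" "poly p r - poly p a = (r - a) * poly (pderiv p) x"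
    using poly_MVT[OF assms(1)] by blast
  obtain y where y: "r < y" "y < b" "poly p b - poly p r = (b - r) * poly (pderiv p) y"
    using poly_MVT[OF assms(2)] by blast
  have "sgn (poly (pderiv p) x) = sgn (poly (pderiv p) y)"
    using x y by (intro sgn_poly_constant nz) auto
  moreover have "poly (pderiv p) x \<noteq> 0" using x y assms nz by auto
  moreover have "poly p a = - (r - a) * poly (pderiv p) x"  "poly p b = (b - r) * poly (pderiv p) y"
    using x(3) y(3) assms(3) by (auto simp: algebra_simps)
  ultimately show ?thesis using assms(1,2)
    by (auto simp: sgn_if mult_less_0_iff zero_less_mult_iff split: if_splits)
qed

lemma sgn_poly_at_top:
  fixes p :: "real poly"
  assumes "p \<noteq> 0"
  shows "\<exists>T. \<forall>x\<ge>T. sgn (poly p x) = sgn (lead_coeff p)"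
proof (cases "lead_coeff p > 0")
  case True
  then show ?thesis using poly_pinfty_gt_lc[of p]
    by (metis less_le_trans sgn_pos)
next
  case False
  then have "lead_coeff (- p) > 0" using assms leading_coeff_0_iff[of p]
    by (simp add: less_le)
  then obtain n where "\<forall>x\<ge>n. lead_coeff (- p) \<le> poly (- p) x" using poly_pinfty_gt_lc[of "- p"] by blast
  then have "\<forall>x\<ge>n. poly p x < 0" using \<open>lead_coeff (- p) > 0\<close> by fastforce
  then show ?thesis using \<open>lead_coeff (- p) > 0\<close> by (auto simp: sgn_if intro!: exI[of _ n])
qed

lemma sgn_poly_at_bot:
  fixes p :: "real poly"
  assumes "p \<noteq> 0"
  shows "\<exists>T. \<forall>x\<le>T. sgn (poly p x) = sgn ((-1) ^ degree p * lead_coeff p)"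
proof -
  let ?r = "pcompose p [:0, -1:]"
  have "?r \<noteq> 0" using assms pcompose_eq_0[of p "[:0,-1:]"] by fastforce
  then obtain T where T: "\<forall>x\<ge>T. sgn (poly ?r x) = sgn (lead_coeff ?r)" using sgn_poly_at_top by blast
  have l: "lead_coeff ?r = (-1) ^ degree p * lead_coeff p"
    by (subst lead_coeff_comp) auto
  show ?thesis
  proof (intro exI[of _ "-T"] allI impI)
    fix x assume "x \<le> - T"
    then have "sgn (poly ?r (-x)) = sgn (lead_coeff ?r)" using T by simp
    then show "sgn (poly p x) = sgn ((-1) ^ degree p * lead_coeff p)"
      unfolding l by (simp add: poly_pcompose)
  qed
qed

text \<open>The extension step for a polynomial \<open>p\<close> whose derivative already occurs. Let \<open>Z\<close> contain all zeros
  of the polynomials in \<open>Q\<close> and one point on either side beyond which \<open>p\<close> and \<open>p'\<close> have the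
  sign of their leading term. In a gap of \<open>Z\<close> the polynomial \<open>p\<close> is strictly monotone, so it has
  a zero there exactly if its signs at the two end points are opposite. The same holds for
  \<open>p'\<close> in the image gap, and the signs at the end points agree by assumption. Hence the
  identification can be bent inside the gap so that the two zeros correspond; after finitely many
  such corrections \<open>Z\<close> contains all zeros of \<open>p\<close>, and the signs agree everywhere.\<close>

lemma sign_match_insert:
  fixes p p' :: "real poly"
  assumes "finite Q" and h: "sign_match h Q"
    and pd: "(pderiv p, pderiv p') \<in> Q" "pderiv p \<noteq> 0"
    and deg: "degree p = degree p'" and lc: "sgn (lead_coeff p) = sgn (lead_coeff p')"
    and zeros: "\<And>q q' t. (q, q') \<in> Q \<Longrightarrow> q \<noteq> 0 \<Longrightarrow> poly q t = 0 \<Longrightarrow>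
       sgn (poly p t) = sgn (poly p' (h t))"
  shows "\<exists>h'. sign_match h' (insert (p, p') Q)"
proof -
  define Z0 where "Z0 = (\<Union>(q, q')\<in>{(q, q')\<in>Q. q \<noteq> 0}. {t. poly q t = 0})"
  have fZ0: "finite Z0" unfolding Z0_def
    by (rule finite_UN_I) (use \<open>finite Q\<close> poly_roots_finite in \<open>auto intro: rev_finite_subset\<close>)
  have p0: "p \<noteq> 0" using pd(2) by auto
  then have p'0: "p' \<noteq> 0" using lc by (metis leading_coeff_0_iff sgn_eq_0_iff)
  obtain T1 T1' where T1: "\<forall>x\<ge>T1. sgn (poly p x) = sgn (lead_coeff p)"
      "\<forall>x\<ge>T1'. sgn (poly p' x) = sgn (lead_coeff p')"
    using sgn_poly_at_top p0 p'0 by meson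
  obtain T0 T0' where T0: "\<forall>x\<le>T0. sgn (poly p x) = sgn ((-1) ^ degree p * lead_coeff p)"
      "\<forall>x\<le>T0'. sgn (poly p' x) = sgn ((-1) ^ degree p' * lead_coeff p')"
    using sgn_poly_at_bot p0 p'0 by meson
  have mono: "strict_mono h" and "surj h" using h by (auto simp: sign_match_def)
  obtain k1 k0 where k: "h k1 = T1'" "h k0 = T0'" using \<open>surj h\<close> by (metis surjD)
  define t1 where "t1 = max T1 k1"
  define t0 where "t0 = min T0 k0"
  have top: "sgn (poly p t) = sgn (poly p' u)" "poly p t \<noteq> 0" "poly p' u \<noteq> 0"
    if "t1 \<le> t" "T1' \<le> u" for t u
  proof -
    have "sgn (poly p t) = sgn (lead_coeff p)" "sgn (poly p' u) = sgn (lead_coeff p)"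
      using T1 that lc by (auto simp: t1_def)
    then show "sgn (poly p t) = sgn (poly p' u)" "poly p t \<noteq> 0" "poly p' u \<noteq> 0"
      using p0 by (metis leading_coeff_0_iff sgn_eq_0_iff)+
  qed
  have bot: "sgn (poly p t) = sgn (poly p' u)" "poly p t \<noteq> 0" "poly p' u \<noteq> 0"
    if "t \<le> t0" "u \<le> T0'" for t u
  proof -
    have "sgn (poly p t) = sgn ((-1) ^ degree p * lead_coeff p)"
      using T0(1) that(1) by (auto simp: t0_def)
    moreover have "sgn (poly p' u) = sgn ((-1) ^ degree p' * lead_coeff p')"
      using T0(2) that(2) by blast
    moreover have "sgn ((-1) ^ degree p' * lead_coeff p') = sgn ((-1) ^ degree p * lead_coeff p)"
      using lc by (simp add: sgn_mult deg)
    moreover have "(-1) ^ degree p * lead_coeff p \<noteq> 0" using p0 by simp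
    ultimately show "sgn (poly p t) = sgn (poly p' u)" "poly p t \<noteq> 0" "poly p' u \<noteq> 0"
      by (metis sgn_eq_0_iff)+
  qed
  have "h k1 \<le> h t1" "h t0 \<le> h k0"
    by (simp_all add: strict_mono_less_eq[OF mono] t1_def t0_def)
  then have ht: "T1' \<le> h t1" "h t0 \<le> T0'"
    using k by simp_all
  \<comment> \<open>The invariant of the corrections: the matching holds for Q, and the finite set Z of points where
    the signs of p and p' are known to agree only grows.\<close>
  define good where "good = (\<lambda>g Z. sign_match g Q \<and> finite Z \<and> Z0 \<subseteq> Z \<and> t0 \<in> Z \<and> t1 \<in> Z \<and>
     T1' \<le> g t1 \<and> g t0 \<le> T0' \<and> (\<forall>z\<in>Z. sgn (poly p z) = sgn (poly p' (g z))))"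
  have no_zero: "poly q u \<noteq> 0" "poly q' (g u) \<noteq> 0"
    if "good g Z" "(q, q') \<in> Q" "q \<noteq> 0" "u \<notin> Z" for g Z q q' u
  proof -
    show *: "poly q u \<noteq> 0" using that by (auto simp: good_def Z0_def)
    have "sgn (poly q u) = sgn (poly q' (g u))" using that by (auto simp: good_def sign_match_def)
    then show "poly q' (g u) \<noteq> 0" using * by (metis sgn_eq_0_iff)
  qed
  have gap: "poly (pderiv p') v \<noteq> 0" "v \<notin> g ` Z"
    if "good g Z" "\<And>z. z \<in> Z \<Longrightarrow> z \<le> \<alpha> \<or> \<beta> \<le> z" "g \<alpha> < v" "v < g \<beta>" for g Z \<alpha> \<beta> v
  proof -
    have m: "strict_mono g" "surj g" using that by (auto simp: good_def sign_match_def)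
    obtain u where u: "v = g u" using m(2) by (metis surjD)
    then have "\<alpha> < u" "u < \<beta>" using that m by (auto simp: strict_mono_less)
    then have "u \<notin> Z" using that(2)[of u] by auto
    then show "poly (pderiv p') v \<noteq> 0" using no_zero(2)[OF that(1) pd(1,2)] u by simp
    show "v \<notin> g ` Z" using \<open>u \<notin> Z\<close> u strict_mono_imp_inj_on[OF m(1)] by (auto dest: injD)
  qed
  have ex: "\<exists>g Z. good g Z \<and> W \<subseteq> Z" if "finite W" "W \<subseteq> {t. poly p t = 0}" for W
    using that
  proof (induction W rule: finite_induct)
    case empty
    have "good h (insert t0 (insert t1 Z0))"
      using h fZ0 ht top(1)[OF order_refl ht(1)] bot(1)[OF order_refl ht(2)] zeros
      by (auto simp: good_def Z0_def)
    then show ?case by blast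
  next
    case (insert r W)
    then obtain f Z where f: "good f Z" "W \<subseteq> Z" by auto
    show ?case
    proof (cases "r \<in> Z")
      case True then show ?thesis using f by blast
    next
      case False
      have m: "strict_mono f" "surj f" using f by (auto simp: good_def sign_match_def)
      have pr: "poly p r = 0" using insert by auto
      have "t0 < r" "r < t1" using top(2)[of r T1'] bot(2)[of r T0'] pr by force+
      then obtain \<alpha> \<beta> where ab: "\<alpha> \<in> Z" "\<beta> \<in> Z" "\<alpha> < r" "r < \<beta>" "\<And>z. z \<in> Z \<Longrightarrow> z \<le> \<alpha> \<or> \<beta> \<le> z"
        using neighbours_in_finite_set[of Z r t0 t1] False f unfolding good_def by metis
      have "poly (pderiv p) u \<noteq> 0" if "\<alpha> < u" "u < \<beta>" for u
        using no_zero(1)[OF f(1) pd, of u] ab(5)[of u] that by auto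
      from poly_sign_change[OF ab(3,4) pr this] have "poly p \<alpha> * poly p \<beta> < 0" .
      moreover have "sgn (poly p \<alpha>) = sgn (poly p' (f \<alpha>))" "sgn (poly p \<beta>) = sgn (poly p' (f \<beta>))"
        using f ab by (auto simp: good_def)
      ultimately have "poly p' (f \<alpha>) * poly p' (f \<beta>) < 0"
        by (metis sgn_mult sgn_less)
      then obtain c' where c': "f \<alpha> < c'" "c' < f \<beta>" "poly p' c' = 0"
        using poly_IVT[of "f \<alpha>" "f \<beta>" p'] ab m by (auto simp: strict_mono_less)
      have fr: "f \<alpha> < f r" "f r < f \<beta>" using ab m by (auto simp: strict_mono_less)
      \<comment> \<open>Bend the target line inside the gap so that the image of r becomes the zero c' of p'.\<close>
      obtain g where g: "strict_mono g" "surj g" "g (f r) = c'"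
          "\<And>s. s \<le> f \<alpha> \<or> f \<beta> \<le> s \<Longrightarrow> g s = s"
        using move_point[OF fr c'(1,2)] by blast
      have fix_Z: "g (f z) = f z" if "z \<in> Z" for z
        using ab(5)[OF that] by (intro g(4)) (auto simp: strict_mono_less_eq[OF m(1)])
      have sg: "sgn (poly q' (g s)) = sgn (poly q' s)" if q: "(q, q') \<in> Q" for q q' s
      proof (cases "q = 0")
        case True
        have "poly q' u = 0" for u
        proof -
          obtain w where "u = f w" using m by (metis surjD)
          moreover have "sgn (poly q w) = sgn (poly q' (f w))"
            using f(1) q by (auto simp: good_def sign_match_def)
          ultimately show ?thesis using True by (simp add: sgn_0_0)
        qed
        then show ?thesis by simp
      next
        case False
        show ?thesis
        proof (cases "s \<le> f \<alpha> \<or> f \<beta> \<le> s")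
          case True then show ?thesis using g(4) by simp
        next
          case False
          have "g (f \<alpha>) < g s" "g s < g (f \<beta>)" using False strict_mono_less[OF g(1)] by auto
          then have gs: "f \<alpha> < g s" "g s < f \<beta>" using fix_Z ab by auto
          show ?thesis
          proof (rule sgn_poly_constant)
            fix u assume "min (g s) s \<le> u" "u \<le> max (g s) s"
            then have u: "f \<alpha> < u" "u < f \<beta>" using gs False by auto
            obtain w where w: "u = f w" using m by (metis surjD)
            have "\<alpha> < w" "w < \<beta>" using u w strict_mono_less[OF m(1)] by auto
            then have "w \<notin> Z" using ab(5)[of w] by auto
            then show "poly q' u \<noteq> 0" using no_zero(2)[OF f(1) q \<open>q \<noteq> 0\<close>] w by blast
          qed
        qed
      qed
      have "sign_match (g \<circ> f) Q"
        unfolding sign_match_def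
      proof (intro conjI)
        show "strict_mono (g \<circ> f)" using g m by (auto simp: strict_mono_def)
        show "surj (g \<circ> f)" using g(2) m(2) by (rule comp_surj[rotated])
        show "\<forall>(q, q')\<in>Q. \<forall>t. sgn (poly q t) = sgn (poly q' ((g \<circ> f) t))"
          using f(1) sg by (fastforce simp: good_def sign_match_def)
      qed
      then have "good (g \<circ> f) (insert r Z)"
        using f(1) fix_Z g(3) c'(3) pr by (auto simp: good_def)
      then show ?thesis using f(2) by blast
    qed
  qed
  obtain g Z where g: "good g Z" and all: "{t. poly p t = 0} \<subseteq> Z"
    using ex[of "{t. poly p t = 0}"] poly_roots_finite[OF p0] by auto
  have m: "strict_mono g" "surj g" using g by (auto simp: good_def sign_match_def)
  have gt: "T1' \<le> g t1" "g t0 \<le> T0'" using g by (auto simp: good_def)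
  have "sgn (poly p t) = sgn (poly p' (g t))" for t
  proof (cases "t \<in> Z \<or> t \<le> t0 \<or> t1 \<le> t")
    case True
    have "t \<le> t0 \<Longrightarrow> g t \<le> T0'" "t1 \<le> t \<Longrightarrow> T1' \<le> g t"
      using gt strict_mono_less_eq[OF m(1)] order_trans by blast+
    then show ?thesis using True g top(1) bot(1) by (auto simp: good_def)
  next
    case False
    then obtain \<alpha> \<beta> where ab: "\<alpha> \<in> Z" "\<beta> \<in> Z" "\<alpha> < t" "t < \<beta>" "\<And>z. z \<in> Z \<Longrightarrow> z \<le> \<alpha> \<or> \<beta> \<le> z"
      using neighbours_in_finite_set[of Z t t0 t1] g unfolding good_def by (metis linorder_not_le)
    have s: "sgn (poly p \<alpha>) = sgn (poly p' (g \<alpha>))" "sgn (poly p \<beta>) = sgn (poly p' (g \<beta>))"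
      using g ab by (auto simp: good_def)
    have nz: "poly p u \<noteq> 0" if "\<alpha> < u" "u < \<beta>" for u
      using all ab(5)[of u] that by auto
    \<comment> \<open>A zero of p' in the image gap would force opposite signs at its ends, hence a zero of p in a
      gap of Z, although Z contains all zeros of p.\<close>
    have nz': "poly p' v \<noteq> 0" if "g \<alpha> < v" "v < g \<beta>" for v
    proof
      assume "poly p' v = 0"
      then have "poly p' (g \<alpha>) * poly p' (g \<beta>) < 0"
        using poly_sign_change[OF that] gap(1)[OF g ab(5)] by blast
      then have "poly p \<alpha> * poly p \<beta> < 0" using s by (metis sgn_mult sgn_less)
      then obtain u where "\<alpha> < u" "u < \<beta>" "poly p u = 0" using poly_IVT[of \<alpha> \<beta> p] ab by auto
      then show False using nz by blast
    qed
    have gm: "g \<alpha> < g t" "g t < g \<beta>" using ab strict_mono_less[OF m(1)] by auto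
    show ?thesis
    proof (cases "poly p \<alpha> = 0")
      case False
      then have "poly p' (g \<alpha>) \<noteq> 0" using s by (metis sgn_eq_0_iff)
      have "sgn (poly p t) = sgn (poly p \<alpha>)"
        by (rule sgn_poly_constant) (metis False ab(3,4) nz le_less_trans max.absorb1 min.absorb2 less_imp_le order_le_less)
      moreover have "sgn (poly p' (g t)) = sgn (poly p' (g \<alpha>))"
        by (rule sgn_poly_constant) (metis \<open>poly p' (g \<alpha>) \<noteq> 0\<close> gm nz' le_less_trans max.absorb1 min.absorb2 less_imp_le order_le_less)
      ultimately show ?thesis using s by simp
    next
      case True
      have "poly p \<beta> \<noteq> 0"
      proof
        assume "poly p \<beta> = 0"
        then obtain u where "\<alpha> < u" "u < \<beta>" "poly (pderiv p) u = 0"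
          using poly_MVT[of \<alpha> \<beta> p] True ab by force
        then show False using no_zero(1)[OF g pd, of u] ab(5)[of u] by auto
      qed
      then have "poly p' (g \<beta>) \<noteq> 0" using s by (metis sgn_eq_0_iff)
      have "sgn (poly p t) = sgn (poly p \<beta>)"
        by (rule sgn_poly_constant) (metis \<open>poly p \<beta> \<noteq> 0\<close> ab(3,4) nz less_le_trans max.absorb2 min.absorb1 less_imp_le order_le_less)
      moreover have "sgn (poly p' (g t)) = sgn (poly p' (g \<beta>))"
        by (rule sgn_poly_constant) (metis \<open>poly p' (g \<beta>) \<noteq> 0\<close> gm nz' less_le_trans max.absorb2 min.absorb1 less_imp_le order_le_less)
      ultimately show ?thesis using s by simp
    qed
  qed
  then have "sign_match g (insert (p, p') Q)"
    using g by (auto simp: good_def sign_match_def)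
  then show ?thesis by blast
qed

section \<open>Coefficients determine the arrangement of signs\<close>

definition poly_family :: "('x::real_normed_vector \<Rightarrow> real poly) \<Rightarrow> bool" where
  "poly_family p \<longleftrightarrow> (\<forall>i. real_polynomial_function (\<lambda>x. coeff (p x) i))"

definition agree_on :: "('x \<Rightarrow> real) set \<Rightarrow> 'x \<Rightarrow> 'x \<Rightarrow> bool" where
  "agree_on F x y \<longleftrightarrow> (\<forall>f\<in>F. sgn (f x) = sgn (f y))"

lemma agree_onD: "agree_on F x y \<Longrightarrow> f \<in> F \<Longrightarrow> sgn (f x) = sgn (f y)"
  by (auto simp: agree_on_def)

lemma sign_match_subset: "sign_match h Q \<Longrightarrow> R \<subseteq> Q \<Longrightarrow> sign_match h R"
  unfolding sign_match_def by blast

lemma sign_matchD: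
  "sign_match h ((\<lambda>p. (p x, p y)) ` ps) \<Longrightarrow> p \<in> ps \<Longrightarrow>
     sgn (poly (p x) t) = sgn (poly (p y) (h t))"
  unfolding sign_match_def by blast

lemma agree_on_Un [simp]: "agree_on (F \<union> G) x y \<longleftrightarrow> agree_on F x y \<and> agree_on G x y"
  by (auto simp: agree_on_def)

lemma sgn_smult: "c > 0 \<Longrightarrow> sgn (c * x) = sgn (x::real)"
  by (simp add: sgn_mult)

text \<open>One step of sign-preserving pseudo-division of \<open>p\<close> by \<open>q\<close>: the coefficient of degree \<open>n\<close> cancels,
  and squaring the leading coefficient of \<open>q\<close> keeps the factor in front of \<open>p\<close> positive. The degree \<open>e\<close> of
  \<open>q\<close> is a parameter because it may vary with \<open>x\<close>; cutting \<open>q\<close> off above \<open>e\<close> makes the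
  formula a polynomial family for every \<open>e\<close>, whether or not \<open>e\<close> is the degree of \<open>q\<close> at \<open>x\<close>.\<close>

definition leading_reduction ::
    "nat \<Rightarrow> nat \<Rightarrow> ('x \<Rightarrow> real poly) \<Rightarrow> ('x \<Rightarrow> real poly) \<Rightarrow> 'x \<Rightarrow> real poly" where
  "leading_reduction n e p q x =
     smult ((coeff (q x) e)\<^sup>2) (p x) -
     smult (coeff (q x) e * coeff (p x) n) (monom 1 (n - e) * poly_cutoff (Suc e) (q x))"

lemma poly_family_leading_reduction:
  assumes "poly_family p" "poly_family q"
  shows "poly_family (leading_reduction n e p q)"
  using assms unfolding poly_family_def leading_reduction_def
proof (intro allI)
  fix i
  assume *: "\<forall>i. real_polynomial_function (\<lambda>x. coeff (p x) i)"
            "\<forall>i. real_polynomial_function (\<lambda>x. coeff (q x) i)"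
  show "real_polynomial_function (\<lambda>x. coeff (smult ((coeff (q x) e)\<^sup>2) (p x) -
     smult (coeff (q x) e * coeff (p x) n) (monom 1 (n - e) * poly_cutoff (Suc e) (q x))) i)"
    using * by (cases "i < n - e"; cases "i - (n - e) < Suc e")
      (auto simp: coeff_monom_mult coeff_poly_cutoff intro!: real_polynomial_function_diff
        real_polynomial_function_power real_polynomial_function.intros(4))
qed

lemma degree_leading_reduction:
  assumes "degree (p x) \<le> Suc D" "e \<le> Suc D"
  shows "degree (leading_reduction (Suc D) e p q x) \<le> D"
proof (rule degree_le, intro allI impI)
  fix i assume "D < i"
  then consider "i = Suc D" | "i > Suc D" by linarith
  then show "coeff (leading_reduction (Suc D) e p q x) i = 0"
  proof cases
    case 1
    then show ?thesis using assms(2)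
      by (simp add: leading_reduction_def coeff_monom_mult coeff_poly_cutoff power2_eq_square)
  next
    case 2
    then have "coeff (p x) i = 0" using assms(1) by (intro coeff_eq_0) auto
    moreover have "\<not> i - (Suc D - e) < Suc e" using 2 assms(2) by auto
    ultimately show ?thesis
      by (simp add: leading_reduction_def coeff_monom_mult coeff_poly_cutoff)
  qed
qed

text \<open>At a zero of \<open>q\<close> the subtracted multiple of \<open>q\<close> vanishes, and a positive multiple of \<open>p\<close> remains.\<close>

lemma sgn_leading_reduction:
  assumes "degree (q x) \<le> e" "coeff (q x) e \<noteq> 0" "poly (q x) t = 0"
  shows "sgn (poly (leading_reduction n e p q x) t) = sgn (poly (p x) t)"
proof -
  have "poly_cutoff (Suc e) (q x) = q x"
    by (rule poly_eqI) (use assms(1) in \<open>auto simp: coeff_poly_cutoff coeff_eq_0\<close>)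
  then show ?thesis using assms(2,3)
    by (simp add: leading_reduction_def sgn_smult)
qed

text \<open>This is the parametric core of quantifier elimination. The outer induction is on a bound for the
  degrees, the inner one on the number of families that attain the bound somewhere. One such family \<open>p\<close> is
  removed in two ways. Where its top coefficient vanishes, \<open>p\<close> equals its truncation. Elsewhere
  the induction hypothesis is applied to the remaining families, the derivative of \<open>p\<close>, and the
  reductions of \<open>p\<close> by all of these. The sign of \<open>p\<close> at a zero of another member is the sign of a
  reduction, hence part of the data that are already matched, and \<open>sign_match_insert\<close> brings \<open>p\<close> back.
  All new families have smaller degree, so the inner measure drops.\<close>

lemma sign_match_from_coefficients:
  fixes ps :: "('x::real_normed_vector \<Rightarrow> real poly) set"
  assumes "finite ps" "\<And>p. p \<in> ps \<Longrightarrow> poly_family p" "\<And>p x. p \<in> ps \<Longrightarrow> degree (p x) \<le> D"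
  shows "\<exists>F. finite F \<and> (\<forall>f\<in>F. real_polynomial_function f) \<and>
           (\<forall>x y. agree_on F x y \<longrightarrow> (\<exists>h. sign_match h ((\<lambda>p. (p x, p y)) ` ps)))"
  using assms
proof (induction D arbitrary: ps)
  case 0
  have const: "poly (p x) t = coeff (p x) 0" if "p \<in> ps" for p x t
  proof -
    have "degree (p x) = 0" using 0(3)[OF that, of x] by simp
    then obtain c where "p x = [:c:]" by (rule degree_eq_zeroE)
    then show ?thesis by simp
  qed
  let ?F = "(\<lambda>p x. coeff (p x) 0) ` ps"
  have "sign_match id ((\<lambda>p. (p x, p y)) ` ps)" if "agree_on ?F x y" for x y
    using that const by (auto simp: sign_match_def agree_on_def strict_mono_def)
  moreover have "finite ?F" "\<forall>f\<in>?F. real_polynomial_function f"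
    using 0 by (auto simp: poly_family_def)
  ultimately show ?case by blast
next
  case (Suc D)
  define high where "high = (\<lambda>ps. {p \<in> ps. \<exists>x::'x. degree (p x :: real poly) > D})"
  show ?case using Suc.prems
  proof (induction "card (high ps)" arbitrary: ps)
    case 0
    then have "high ps = {}" by (simp add: high_def)
    then have "\<And>p x. p \<in> ps \<Longrightarrow> degree (p x) \<le> D" by (force simp: high_def not_less)
    then show ?case using Suc.IH 0 by blast
  next
    case (Suc n)
    then have "high ps \<noteq> {}" by auto
    then obtain p where p: "p \<in> ps" "p \<in> high ps" by (auto simp: high_def)
    have fh: "finite (high ps)" using Suc.prems by (simp add: high_def)
    define qs where "qs = insert (\<lambda>x. pderiv (p x)) (ps - {p})"
    define cut where "cut = (\<lambda>x. poly_cutoff (Suc D) (p x))"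
    define ps1 where "ps1 = insert cut (ps - {p})"
    define ps2 where "ps2 = qs \<union> (\<lambda>(e, q). leading_reduction (Suc D) e p q) ` ({..Suc D} \<times> qs)"
    have fam: "poly_family q" if "q \<in> ps" for q using Suc.prems that by blast
    have deg: "degree (q x) \<le> Suc D" if "q \<in> ps" for q x using Suc.prems that by blast
    have degp': "degree (pderiv (p x)) \<le> D" for x
      using deg[OF p(1), of x] by (simp add: degree_pderiv)
    have fampd: "poly_family (\<lambda>x. pderiv (p x))"
      using fam[OF p(1)] by (auto simp: poly_family_def coeff_pderiv)
    have famqs: "poly_family q" if "q \<in> qs" for q using that fam fampd by (auto simp: qs_def)
    have degqs: "degree (q x) \<le> Suc D" if "q \<in> qs" for q x
      using that deg degp'[of x] by (auto simp: qs_def)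
    have fin: "finite qs" "finite ps1" "finite ps2"
      using Suc.prems by (auto simp: qs_def ps1_def ps2_def)
    have degcut: "degree (cut x) \<le> D" for x
      unfolding cut_def by (rule degree_le) (auto simp: coeff_poly_cutoff)
    have famcut: "poly_family cut"
      unfolding poly_family_def
    proof
      fix i
      show "real_polynomial_function (\<lambda>x. coeff (cut x) i)"
        using fam[OF p(1)]
        by (cases "i < Suc D") (auto simp: cut_def coeff_poly_cutoff poly_family_def)
    qed
    have degred: "degree (leading_reduction (Suc D) e p q x) \<le> D" if "e \<le> Suc D" for e q x
      by (intro degree_leading_reduction deg[OF p(1)] that)
    have ih: "\<exists>F. finite F \<and> (\<forall>f\<in>F. real_polynomial_function f) \<and>
           (\<forall>x y. agree_on F x y \<longrightarrow> (\<exists>h. sign_match h ((\<lambda>p. (p x, p y)) ` rs)))"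
      if "high rs = high ps - {p}" "finite rs" "\<And>q. q \<in> rs \<Longrightarrow> poly_family q"
         "\<And>q x. q \<in> rs \<Longrightarrow> degree (q x) \<le> Suc D" for rs
      by (rule Suc.hyps(1)) (use that Suc(2) p(2) fh in \<open>auto simp: card_Diff_singleton\<close>)
    have "high ps1 = high ps - {p}"
      using degcut by (auto simp: high_def ps1_def not_less) (metis not_le)+
    moreover have "poly_family q" "degree (q x) \<le> Suc D" if "q \<in> ps1" for q x
    proof -
      show "poly_family q" using that famcut fam by (auto simp: ps1_def)
      show "degree (q x) \<le> Suc D" using that deg degcut[of x] by (auto simp: ps1_def)
    qed
    ultimately obtain F1 where F1: "finite F1" "\<forall>f\<in>F1. real_polynomial_function f"
      "\<And>x y. agree_on F1 x y \<Longrightarrow> \<exists>h. sign_match h ((\<lambda>p. (p x, p y)) ` ps1)"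
      using ih[of ps1] fin by blast
    have "high ps2 = high ps - {p}"
      using degred degp' by (auto simp: high_def ps2_def qs_def) (metis not_le)+
    moreover have "poly_family q" "degree (q x) \<le> Suc D" if "q \<in> ps2" for q x
    proof -
      show "poly_family q" using that famqs poly_family_leading_reduction[OF fam[OF p(1)]]
        by (auto simp: ps2_def)
      from that consider "q \<in> qs" | e r where "e \<le> Suc D" "q = leading_reduction (Suc D) e p r"
        by (auto simp: ps2_def)
      then show "degree (q x) \<le> Suc D"
        using degqs degred[of _ _ x, THEN le_SucI] by cases simp_all
    qed
    ultimately obtain F2 where F2: "finite F2" "\<forall>f\<in>F2. real_polynomial_function f"
      "\<And>x y. agree_on F2 x y \<Longrightarrow> \<exists>h. sign_match h ((\<lambda>p. (p x, p y)) ` ps2)"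
      using ih[of ps2] fin by blast
    \<comment> \<open>The signs of the coefficients decide which of the two cases applies, and they fix the degrees
      of all polynomials involved.\<close>
    define C where "C = (\<lambda>(i, q) x. coeff (q x) i) ` ({..Suc D} \<times> (insert p qs))"
    have C: "finite C" "\<forall>f\<in>C. real_polynomial_function f"
      using fin famqs fam[OF p(1)] by (auto simp: C_def poly_family_def)
    have "\<exists>h. sign_match h ((\<lambda>p. (p x, p y)) ` ps)"
      if F: "agree_on (C \<union> F1 \<union> F2) x y" for x y
    proof -
      have co: "sgn (coeff (q x) i) = sgn (coeff (q y) i)" if "q \<in> insert p qs" "i \<le> Suc D" for q i
      proof -
        have "(\<lambda>x. coeff (q x) i) \<in> C"
          unfolding C_def by (rule image_eqI[of _ _ "(i, q)"]) (use that in auto)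
        then show ?thesis using agree_onD[of C x y] F by simp
      qed
      have coz: "coeff (q x) i = 0 \<longleftrightarrow> coeff (q y) i = 0" if "q \<in> insert p qs" for q i
      proof (cases "i \<le> Suc D")
        case True then show ?thesis using co[OF that True] by (metis sgn_eq_0_iff)
      next
        case False then show ?thesis using that deg[OF p(1)] degqs
          by (metis coeff_eq_0 insertE le_less_trans not_le)
      qed
      have dg: "degree (q x) = degree (q y)" if "q \<in> insert p qs" for q
      proof (rule antisym)
        show "degree (q x) \<le> degree (q y)"
          using coz[OF that] by (intro degree_le) (simp add: coeff_eq_0)
        show "degree (q y) \<le> degree (q x)"
          using coz[OF that, symmetric] by (intro degree_le) (simp add: coeff_eq_0)
      qed
      show ?thesis
      proof (cases "coeff (p x) (Suc D) = 0")
        case True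
        have cutp: "cut z = p z" if "coeff (p z) (Suc D) = 0" for z
        proof (rule poly_eqI)
          fix i show "coeff (cut z) i = coeff (p z) i"
            using that deg[OF p(1), of z]
            by (cases "i = Suc D") (auto simp: cut_def coeff_poly_cutoff coeff_eq_0)
        qed
        have "cut x = p x" "cut y = p y" using cutp True coz[of p "Suc D"] by auto
        then have "(\<lambda>p. (p x, p y)) ` ps1 = (\<lambda>p. (p x, p y)) ` ps"
          using p(1) by (auto simp: ps1_def)
        then show ?thesis using F1(3)[of x y] F by auto
      next
        case False
        have dp: "degree (p x) = Suc D"
          using False deg[OF p(1)] le_degree by (intro antisym) auto
        obtain h where h: "sign_match h ((\<lambda>p. (p x, p y)) ` ps2)" using F2(3)[of x y] F by auto
        have "sign_match h ((\<lambda>p. (p x, p y)) ` qs)"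
          by (rule sign_match_subset[OF h]) (auto simp: ps2_def)
        then have "\<exists>h. sign_match h (insert (p x, p y) ((\<lambda>p. (p x, p y)) ` qs))"
        proof (rule sign_match_insert[rotated])
          show "finite ((\<lambda>p. (p x, p y)) ` qs)" using fin by simp
          show "(pderiv (p x), pderiv (p y)) \<in> (\<lambda>p. (p x, p y)) ` qs" by (auto simp: qs_def)
          show "pderiv (p x) \<noteq> 0" using dp by (simp add: pderiv_eq_0_iff)
          show "degree (p x) = degree (p y)" using dg by simp
          show "sgn (lead_coeff (p x)) = sgn (lead_coeff (p y))" using co[of p "Suc D"] dp dg[of p] by simp
          fix r r' t
          assume "(r, r') \<in> (\<lambda>p. (p x, p y)) ` qs" and nz: "r \<noteq> 0" "poly r t = 0"
          then obtain q where q: "q \<in> qs" "r = q x" "r' = q y" by auto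
          \<comment> \<open>Among the reductions of p by q, the one for the actual degree of q at x carries the sign of p.\<close>
          define e where "e = degree (q x)"
          have lcq: "coeff (q x) e \<noteq> 0"
            unfolding e_def using nz(1) q(2) by (simp only: leading_coeff_0_iff not_False_eq_True)
          have e: "e \<le> Suc D" "degree (q x) \<le> e" "degree (q y) \<le> e"
             "coeff (q x) e \<noteq> 0" "coeff (q y) e \<noteq> 0"
            using q(1) lcq degqs dg[of q] coz[of q e] by (auto simp: e_def)
          have "sgn (poly (q x) t) = sgn (poly (q y) (h t))"
            using q by (intro sign_matchD[OF h]) (auto simp: ps2_def)
          then have z: "poly (q y) (h t) = 0" "poly (q x) t = 0"
            using nz q by (metis sgn_eq_0_iff)+
          have "leading_reduction (Suc D) e p q \<in> ps2"
            unfolding ps2_def by (rule UnI2, rule image_eqI[of _ _ "(e, q)"]) (use q e in auto)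
          then have "sgn (poly (leading_reduction (Suc D) e p q x) t) =
              sgn (poly (leading_reduction (Suc D) e p q y) (h t))"
            by (rule sign_matchD[OF h])
          then show "sgn (poly (p x) t) = sgn (poly (p y) (h t))"
            using sgn_leading_reduction[of q x e t] sgn_leading_reduction[of q y e "h t"] e z by metis
        qed
        moreover have "(\<lambda>p. (p x, p y)) ` ps \<subseteq> insert (p x, p y) ((\<lambda>p. (p x, p y)) ` qs)"
          using p(1) by (auto simp: qs_def)
        ultimately show ?thesis using sign_match_subset by blast
      qed
    qed
    then show ?case using C F1(1,2) F2(1,2) by (intro exI[of _ "C \<union> F1 \<union> F2"]) auto
  qed
qed

section \<open>Projection of sets described by polynomial signs\<close>

text \<open>These are the finite unions of cells on which finitely many polynomial functions have constant sign,
  that is, semialgebraic sets, but without reference to a normal form or to coordinates.\<close>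

definition sign_determined :: "'x::real_normed_vector set \<Rightarrow> bool" where
  "sign_determined S \<longleftrightarrow> (\<exists>F. finite F \<and> (\<forall>f\<in>F. real_polynomial_function f) \<and>
     (\<forall>x y. agree_on F x y \<longrightarrow> x \<in> S \<longrightarrow> y \<in> S))"

lemma agree_on_sym: "agree_on F x y \<Longrightarrow> agree_on F y x"
  by (simp add: agree_on_def)

lemma sign_determined_pos:
  assumes "real_polynomial_function f"
  shows "sign_determined {x. f x > 0}"
  unfolding sign_determined_def
proof (intro exI[of _ "{f}"] conjI allI impI)
  fix x y assume "agree_on {f} x y" "x \<in> {x. f x > 0}"
  then have "sgn (f y) = 1" by (simp add: agree_on_def)
  then show "y \<in> {x. f x > 0}" by (simp add: sgn_1_pos)
qed (use assms in auto)

lemma sign_determined_not: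
  assumes "sign_determined {x. P x}"
  shows "sign_determined {x. \<not> P x}"
proof -
  obtain F where F: "finite F" "\<forall>f\<in>F. real_polynomial_function f"
    "\<And>x y. agree_on F x y \<Longrightarrow> P x \<Longrightarrow> P y" using assms by (auto simp: sign_determined_def)
  show ?thesis unfolding sign_determined_def
    by (intro exI[of _ F]) (use F(1,2) F(3)[OF agree_on_sym] in auto)
qed

lemma sign_determined_conj:
  assumes "sign_determined {x. P x}" "sign_determined {x. Q x}"
  shows "sign_determined {x. P x \<and> Q x}"
proof -
  obtain F where F: "finite F" "\<forall>f\<in>F. real_polynomial_function f"
    "\<And>x y. agree_on F x y \<Longrightarrow> P x \<Longrightarrow> P y" using assms(1) by (auto simp: sign_determined_def)
  obtain G where G: "finite G" "\<forall>f\<in>G. real_polynomial_function f"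
    "\<And>x y. agree_on G x y \<Longrightarrow> Q x \<Longrightarrow> Q y" using assms(2) by (auto simp: sign_determined_def)
  show ?thesis unfolding sign_determined_def
    by (intro exI[of _ "F \<union> G"]) (use F G in auto)
qed

lemma sign_determined_disj:
  assumes "sign_determined {x. P x}" "sign_determined {x. Q x}"
  shows "sign_determined {x. P x \<or> Q x}"
  using sign_determined_not[OF sign_determined_conj[OF assms[THEN sign_determined_not]]] by simp

lemma sign_determined_imp:
  assumes "sign_determined {x. P x}" "sign_determined {x. Q x}"
  shows "sign_determined {x. P x \<longrightarrow> Q x}"
  using sign_determined_disj[OF assms(1)[THEN sign_determined_not] assms(2)]
  by simp

lemma sign_determined_nonneg:
  assumes "real_polynomial_function f"
  shows "sign_determined {x. f x \<ge> 0}"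
  using sign_determined_not[OF sign_determined_pos[OF real_polynomial_function_minus[OF assms]]]
  by (simp add: not_less)

lemma sign_determined_vimage:
  assumes "sign_determined S" "polynomial_function g"
  shows "sign_determined {x. g x \<in> S}"
proof -
  obtain F where F: "finite F" "\<forall>f\<in>F. real_polynomial_function f"
    "\<And>x y. agree_on F x y \<Longrightarrow> x \<in> S \<Longrightarrow> y \<in> S" using assms(1) by (auto simp: sign_determined_def)
  show ?thesis unfolding sign_determined_def
  proof (intro exI[of _ "(\<lambda>f. f \<circ> g) ` F"] conjI allI impI)
    show "\<forall>f\<in>(\<lambda>f. f \<circ> g) ` F. real_polynomial_function f"
      using F(2) assms(2) by (auto intro!: real_polynomial_function_compose)
    fix x y assume "agree_on ((\<lambda>f. f \<circ> g) ` F) x y" "x \<in> {x. g x \<in> S}"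
    then show "y \<in> {x. g x \<in> S}" using F(3)[of "g x" "g y"] by (simp add: agree_on_def)
  qed (use F in auto)
qed

lemma poly_family_along_line:
  assumes "real_polynomial_function f"
  shows "\<exists>p N. poly_family p \<and> (\<forall>x. degree (p x) \<le> N) \<and> (\<forall>x t. f (x + t *\<^sub>R b) = poly (p x) t)"
  using assms
proof induction
  case (linear f)
  interpret bounded_linear f by fact
  have "poly_family (\<lambda>x. [:f x, f b:])" unfolding poly_family_def
  proof
    fix i show "real_polynomial_function (\<lambda>x. coeff [:f x, f b:] i)"
      using real_polynomial_function.intros(1)[OF bounded_linear_axioms] real_polynomial_function.intros(2)
      by (cases i; cases "i - 1") (auto simp: coeff_pCons)
  qed
  then show ?case
    by (intro exI[of _ "\<lambda>x. [:f x, f b:]"] exI[of _ 1]) (auto simp: add scaleR)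
next
  case (const c)
  then show ?case
    by (intro exI[of _ "\<lambda>x. [:c:]"] exI[of _ 0]) (auto simp: poly_family_def)
next
  case (add f g)
  then obtain p q M N where
    *: "poly_family p" "\<forall>x. degree (p x) \<le> M" "\<forall>x t. f (x + t *\<^sub>R b) = poly (p x) t"
    "poly_family q" "\<forall>x. degree (q x) \<le> N" "\<forall>x t. g (x + t *\<^sub>R b) = poly (q x) t" by metis
  have "degree (p x + q x) \<le> max M N" for x
    using *(2,5) by (intro degree_add_le) (auto simp: le_max_iff_disj)
  then show ?case using *
    by (intro exI[of _ "\<lambda>x. p x + q x"] exI[of _ "max M N"]) (auto simp: poly_family_def)
next
  case (mult f g)
  then obtain p q M N where
    *: "poly_family p" "\<forall>x. degree (p x) \<le> M" "\<forall>x t. f (x + t *\<^sub>R b) = poly (p x) t"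
    "poly_family q" "\<forall>x. degree (q x) \<le> N" "\<forall>x t. g (x + t *\<^sub>R b) = poly (q x) t" by metis
  have "degree (p x * q x) \<le> M + N" for x
    using *(2,5) degree_mult_le[of "p x" "q x"] by (meson add_mono order_trans)
  then show ?case using *
    by (intro exI[of _ "\<lambda>x. p x * q x"] exI[of _ "M + N"])
      (auto simp: poly_family_def coeff_mult intro!: real_polynomial_function_sum)
qed

text \<open>If the signs of the coefficient functions agree at \<open>x\<close> and \<open>y\<close>, then a point \<open>x + t b\<close> of \<open>S\<close> is
  matched with \<open>y + h(t) b\<close>, where all polynomials describing \<open>S\<close> have the same signs.\<close>

lemma sign_determined_project_line:
  fixes S :: "'x::real_normed_vector set"
  assumes "sign_determined S"
  shows "sign_determined {x. \<exists>t. x + t *\<^sub>R b \<in> S}"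
proof -
  obtain F where F: "finite F" "\<forall>f\<in>F. real_polynomial_function f"
    "\<And>x y. agree_on F x y \<Longrightarrow> x \<in> S \<Longrightarrow> y \<in> S" using assms by (auto simp: sign_determined_def)
  obtain p N where p: "\<And>f. f \<in> F \<Longrightarrow> poly_family (p f)"
     "\<And>f x. f \<in> F \<Longrightarrow> degree (p f x) \<le> N f" "\<And>f x t. f \<in> F \<Longrightarrow> f (x + t *\<^sub>R b) = poly (p f x) t"
    using poly_family_along_line[of _ b] F(2) by metis
  have "degree (q x) \<le> Max (N ` F)" if "q \<in> p ` F" for q x
    using that p(2) F(1) by (force intro: order_trans Max_ge)
  then have "\<exists>G. finite G \<and> (\<forall>f\<in>G. real_polynomial_function f) \<and>
     (\<forall>x y. agree_on G x y \<longrightarrow> (\<exists>h. sign_match h ((\<lambda>q. (q x, q y)) ` (p ` F))))"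
    using F(1) p(1) by (intro sign_match_from_coefficients) auto
  then obtain G where G: "finite G" "\<forall>f\<in>G. real_polynomial_function f"
     "\<And>x y. agree_on G x y \<Longrightarrow> \<exists>h. sign_match h ((\<lambda>q. (q x, q y)) ` (p ` F))"
    by blast
  show ?thesis unfolding sign_determined_def
  proof (intro exI[of _ G] conjI allI impI)
    fix x y assume "agree_on G x y" "x \<in> {x. \<exists>t. x + t *\<^sub>R b \<in> S}"
    then obtain h t where h: "sign_match h ((\<lambda>q. (q x, q y)) ` (p ` F))" and t: "x + t *\<^sub>R b \<in> S"
      using G(3) by blast
    have "agree_on F (x + t *\<^sub>R b) (y + h t *\<^sub>R b)"
      unfolding agree_on_def
    proof
      fix f assume f: "f \<in> F"
      then have "sgn (poly (p f x) t) = sgn (poly (p f y) (h t))" by (intro sign_matchD[OF h]) simp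
      then show "sgn (f (x + t *\<^sub>R b)) = sgn (f (y + h t *\<^sub>R b))" using p(3)[OF f] by simp
    qed
    then show "y \<in> {x. \<exists>t. x + t *\<^sub>R b \<in> S}" using F(3) t by blast
  qed (use G in auto)
qed

text \<open>A vector quantifier is a succession of projections along the basis directions of the second factor.\<close>

lemma sign_determined_ex:
  fixes P :: "'x::real_normed_vector \<Rightarrow> 'y::euclidean_space \<Rightarrow> bool"
  assumes "sign_determined {z. P (fst z) (snd z)}"
  shows "sign_determined {x. \<exists>y. P x y}"
proof -
  let ?S = "{z. P (fst z) (snd z)}"
  have *: "sign_determined {z. \<exists>c. z + (0, \<Sum>b\<in>B. c b *\<^sub>R b) \<in> ?S}" if "finite B" for B :: "'y set"
    using that
  proof induction
    case empty
    then show ?case using assms by simp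
  next
    case (insert b B)
    have "(\<exists>c. z + (0, \<Sum>b\<in>insert b B. c b *\<^sub>R b) \<in> ?S) \<longleftrightarrow>
      (\<exists>t. z + t *\<^sub>R (0, b) \<in> {z. \<exists>c. z + (0, \<Sum>b\<in>B. c b *\<^sub>R b) \<in> ?S})" (is "?L \<longleftrightarrow> ?R") for z
    proof
      assume ?L
      then obtain c where "z + (0, \<Sum>b\<in>insert b B. c b *\<^sub>R b) \<in> ?S" by blast
      then have "z + c b *\<^sub>R (0, b) \<in> {z. \<exists>c. z + (0, \<Sum>b\<in>B. c b *\<^sub>R b) \<in> ?S}"
        using insert by (auto simp: add_ac)
      then show ?R by blast
    next
      assume ?R
      then obtain t c where tc: "z + t *\<^sub>R (0, b) + (0, \<Sum>b\<in>B. c b *\<^sub>R b) \<in> ?S" by blast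
      have "(\<Sum>b'\<in>B. (c(b := t)) b' *\<^sub>R b') = (\<Sum>b\<in>B. c b *\<^sub>R b)"
        using insert by (intro sum.cong) auto
      then have "z + (0, \<Sum>b'\<in>insert b B. (c(b := t)) b' *\<^sub>R b') \<in> ?S"
        using tc insert by (simp add: add_ac)
      then show ?L by blast
    qed
    then show ?case using sign_determined_project_line[OF insert(3), of "(0, b)"] by simp
  qed
  have "(\<exists>y. P x y) \<longleftrightarrow> (x, 0) \<in> {z. \<exists>c. z + (0, \<Sum>b\<in>Basis. c b *\<^sub>R b) \<in> ?S}" for x
    by (auto intro: exI[of _ "\<lambda>b. _ \<bullet> b"] simp: euclidean_representation)
  then have "{x. \<exists>y. P x y} = {x. (x, 0) \<in> {z. \<exists>c. z + (0, \<Sum>b\<in>Basis. c b *\<^sub>R b) \<in> ?S}}"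
    by blast
  moreover have "polynomial_function (\<lambda>x::'x. (x, 0::'y))"
    by (intro polynomial_function_bounded_linear bounded_linear_Pair bounded_linear_ident bounded_linear_zero)
  ultimately show ?thesis
    using sign_determined_vimage[OF *[OF finite_Basis], of "\<lambda>x. (x, 0)"] by (simp only:)
qed

lemma sign_determined_all:
  fixes P :: "'x::real_normed_vector \<Rightarrow> 'y::euclidean_space \<Rightarrow> bool"
  assumes "sign_determined {z. P (fst z) (snd z)}"
  shows "sign_determined {x. \<forall>y. P x y}"
  using sign_determined_not[OF sign_determined_ex[OF sign_determined_not[OF assms]]] by simp

section \<open>Hoelder decay of planar slices\<close>

text \<open>The outer variable of \<open>G\<close> is the first argument \<open>t\<close>, its coefficients are polynomials in \<open>s\<close>. This makes
  it possible to split off powers of \<open>t\<close> below.\<close>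

lemma real_polynomial_function_pair:
  fixes f :: "real \<times> real \<Rightarrow> real"
  assumes "real_polynomial_function f"
  shows "\<exists>G. \<forall>t s. f (t, s) = poly (poly G [:t:]) s"
  using assms
proof induction
  case (linear f)
  interpret bounded_linear f by fact
  have eq: "f (t, s) = t * f (1, 0) + s * f (0, 1)" for t s
    using add[of "t *\<^sub>R (1, 0)" "s *\<^sub>R (0, 1)"] scaleR[of t "(1, 0)"] scaleR[of s "(0, 1)"] by simp
  show ?case
    by (intro exI[of _ "[:[:0, f (0, 1):], [:f (1, 0):]:]"] allI, subst eq) simp
next
  case (const c)
  show ?case by (intro exI[of _ "[:[:c:]:]"]) simp
next
  case (add f g)
  then obtain G H where "\<forall>t s. f (t, s) = poly (poly G [:t:]) s" "\<forall>t s. g (t, s) = poly (poly H [:t:]) s"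
    by blast
  then show ?case by (intro exI[of _ "G + H"]) simp
next
  case (mult f g)
  then obtain G H where "\<forall>t s. f (t, s) = poly (poly G [:t:]) s" "\<forall>t s. g (t, s) = poly (poly H [:t:]) s"
    by blast
  then show ?case by (intro exI[of _ "G * H"]) simp
qed

lemma poly_poly_bounded_on_unit_square:
  fixes H :: "real poly poly"
  shows "\<exists>M\<ge>0. \<forall>t s. 0 \<le> t \<and> t \<le> 1 \<and> 0 \<le> s \<and> s \<le> 1 \<longrightarrow> \<bar>poly (poly H [:t:]) s\<bar> \<le> M"
proof (induction H)
  case 0
  show ?case by (intro exI[of _ 0]) simp
next
  case (pCons a H)
  then obtain M where M: "M \<ge> 0"
    "\<And>t s. 0 \<le> t \<and> t \<le> 1 \<and> 0 \<le> s \<and> s \<le> 1 \<Longrightarrow> \<bar>poly (poly H [:t:]) s\<bar> \<le> M" by blast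
  have "bounded (poly a ` {0..1})"
    by (intro compact_imp_bounded compact_continuous_image continuous_intros compact_Icc)
  then obtain N where N: "\<forall>s\<in>{0..1}. \<bar>poly a s\<bar> \<le> N"
    by (auto simp: bounded_iff)
  have "\<bar>poly (poly (pCons a H) [:t:]) s\<bar> \<le> N + M" if "0 \<le> t \<and> t \<le> 1 \<and> 0 \<le> s \<and> s \<le> 1" for t s
  proof -
    have "\<bar>t * poly (poly H [:t:]) s\<bar> \<le> 1 * M"
      using that M(2)[OF that] unfolding abs_mult by (intro mult_mono) auto
    then show ?thesis using N[rule_format, of s] that by simp
  qed
  moreover have "N \<ge> 0" using N[rule_format, of 0] by simp
  ultimately show ?case using M(1) by (intro exI[of _ "N + M"]) auto
qed

text \<open>A factor \<open>t\<close> contributes no zero with \<open>t > 0\<close>, so the value at \<open>t = 0\<close> may be assumed to be a nonzero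
  polynomial \<open>a\<close> in \<open>s\<close>. If \<open>a = s^k u\<close> with \<open>u 0 \<noteq> 0\<close>, then at a zero the quantity \<open>s^k\<close> is comparable to
  \<open>\<bar>a s\<bar>\<close>, and \<open>\<bar>a s\<bar>\<close> is \<open>t\<close> times a bounded quantity.\<close>

lemma zeros_of_bivariate_poly_Hoelder:
  fixes G :: "real poly poly"
  assumes "G \<noteq> 0"
  shows "\<exists>m C \<eta>. C > 0 \<and> \<eta> > 0 \<and> \<eta> \<le> 1 \<and>
    (\<forall>t s. 0 < t \<and> t < \<eta> \<and> 0 < s \<and> s < \<eta> \<and> poly (poly G [:t:]) s = 0 \<longrightarrow> s ^ m \<le> C * t)"
  using assms
proof (induction G)
  case 0
  then show ?case by simp
next
  case (pCons a H)
  show ?case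
  proof (cases "a = 0")
    case True
    then have "H \<noteq> 0" using pCons by auto
    then obtain m C \<eta> where "C > 0" "\<eta> > 0" "\<eta> \<le> 1"
      "\<forall>t s. 0 < t \<and> t < \<eta> \<and> 0 < s \<and> s < \<eta> \<and> poly (poly H [:t:]) s = 0 \<longrightarrow> s ^ m \<le> C * t"
      using pCons.IH by blast
    then show ?thesis using True by (intro exI[of _ m] exI[of _ C] exI[of _ \<eta>]) auto
  next
    case False
    then obtain u where u: "a = [:-0, 1:] ^ order 0 a * u" "\<not> [:-0, 1:] dvd u"
      using order_decomp by blast
    define k where "k = order 0 a"
    have u0: "poly u 0 \<noteq> 0" using u(2) by (simp add: poly_eq_0_iff_dvd)
    have "(poly u \<longlongrightarrow> poly u 0) (at 0)" using poly_isCont isContD by blast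
    then have "((\<lambda>s. \<bar>poly u s\<bar>) \<longlongrightarrow> \<bar>poly u 0\<bar>) (at 0)" by (rule tendsto_rabs)
    then have "\<forall>\<^sub>F s in at 0. \<bar>poly u 0\<bar> / 2 < \<bar>poly u s\<bar>"
      by (rule order_tendstoD) (use u0 in auto)
    then obtain e where e: "e > 0" "\<And>s. 0 < s \<Longrightarrow> s < e \<Longrightarrow> \<bar>poly u 0\<bar> / 2 < \<bar>poly u s\<bar>"
      unfolding eventually_at by (auto simp: dist_real_def)
    define \<mu> where "\<mu> = \<bar>poly u 0\<bar> / 2"
    have \<mu>: "\<mu> > 0" using u0 by (simp add: \<mu>_def)
    obtain M where M: "M \<ge> 0"
      "\<And>t s. 0 \<le> t \<and> t \<le> 1 \<and> 0 \<le> s \<and> s \<le> 1 \<Longrightarrow> \<bar>poly (poly H [:t:]) s\<bar> \<le> M"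
      using poly_poly_bounded_on_unit_square[of H] by blast
    have "s ^ k \<le> (M / \<mu> + 1) * t"
      if *: "0 < t \<and> t < min e 1 \<and> 0 < s \<and> s < min e 1 \<and> poly (poly (pCons a H) [:t:]) s = 0" for t s
    proof -
      have "poly a s = s ^ k * poly u s"
        unfolding k_def by (subst u(1)) (simp add: poly_power)
      then have "s ^ k * poly u s = - (t * poly (poly H [:t:]) s)" using * by simp
      then have "\<bar>s ^ k * poly u s\<bar> = \<bar>t * poly (poly H [:t:]) s\<bar>" by simp
      then have eq: "s ^ k * \<bar>poly u s\<bar> = t * \<bar>poly (poly H [:t:]) s\<bar>" using * by (simp add: abs_mult)
      have "s ^ k * \<mu> \<le> s ^ k * \<bar>poly u s\<bar>"
        using e(2)[of s] * by (intro mult_left_mono) (auto simp: \<mu>_def)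
      also have "\<dots> \<le> t * M" unfolding eq using M(2)[of t s] * by (intro mult_left_mono) auto
      finally have "s ^ k \<le> M / \<mu> * t" using \<mu> by (simp add: field_simps)
      also have "\<dots> \<le> (M / \<mu> + 1) * t" using * by (simp add: algebra_simps)
      finally show ?thesis .
    qed
    moreover have "M / \<mu> + 1 > 0" using M \<mu> by (simp add: add_nonneg_pos)
    ultimately show ?thesis using e(1)
      by (intro exI[of _ k] exI[of _ "M / \<mu> + 1"] exI[of _ "min e 1"]) auto
  qed
qed

text \<open>The value at \<open>s'\<close> witnesses that \<open>f\<close> is not the zero polynomial. Exponents and constants of the
  single functions can simply be added, because \<open>s\<close> stays below 1.\<close>

lemma zeros_of_polynomial_functions_Hoelder:
  fixes F :: "(real \<times> real \<Rightarrow> real) set"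
  assumes "finite F" "\<forall>f\<in>F. real_polynomial_function f"
  shows "\<exists>m C \<eta>. C > 0 \<and> \<eta> > 0 \<and> \<eta> \<le> 1 \<and>
    (\<forall>f\<in>F. \<forall>t s s'. 0 < t \<and> t < \<eta> \<and> 0 < s \<and> s < \<eta> \<and> f (t, s) = 0 \<and> f (t, s') \<noteq> 0 \<longrightarrow> s ^ m \<le> C * t)"
  using assms
proof (induction F)
  case empty
  show ?case by (intro exI[of _ 0] exI[of _ 1]) auto
next
  case (insert f F)
  then have "\<exists>m C \<eta>. C > 0 \<and> \<eta> > 0 \<and> \<eta> \<le> 1 \<and>
    (\<forall>f\<in>F. \<forall>t s s'. 0 < t \<and> t < \<eta> \<and> 0 < s \<and> s < \<eta> \<and> f (t, s) = 0 \<and> f (t, s') \<noteq> 0 \<longrightarrow> s ^ m \<le> C * t)"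
    by simp
  then obtain m C \<eta> where 1: "C > 0" "\<eta> > 0" "\<eta> \<le> 1"
    "\<And>f t s s'. f \<in> F \<Longrightarrow> 0 < t \<and> t < \<eta> \<and> 0 < s \<and> s < \<eta> \<and> f (t, s) = 0 \<and> f (t, s') \<noteq> 0 \<Longrightarrow> s ^ m \<le> C * t"
    by metis
  obtain G where G: "\<And>t s. f (t, s) = poly (poly G [:t:]) s"
    using real_polynomial_function_pair[of f] insert by blast
  obtain n B \<epsilon> where 2: "B > 0" "\<epsilon> > 0" "\<epsilon> \<le> 1"
    "\<And>t s s'. 0 < t \<and> t < \<epsilon> \<and> 0 < s \<and> s < \<epsilon> \<and> f (t, s) = 0 \<and> f (t, s') \<noteq> 0 \<Longrightarrow> s ^ n \<le> B * t"
  proof (cases "G = 0")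
    case True
    \<comment> \<open>The zero polynomial has no value different from 0, so there is nothing to bound.\<close>
    show ?thesis by (rule that[of 1 1]) (auto simp: G True)
  next
    case False
    then show ?thesis using zeros_of_bivariate_poly_Hoelder[OF False] that unfolding G by metis
  qed
  have "s ^ (m + n) \<le> (C + B) * t"
    if g: "g \<in> insert f F" and t: "0 < t \<and> t < min \<eta> \<epsilon> \<and> 0 < s \<and> s < min \<eta> \<epsilon> \<and> g (t, s) = 0 \<and> g (t, s') \<noteq> 0"
    for g t s s'
  proof -
    have "s ^ (m + n) \<le> s ^ m" "s ^ (m + n) \<le> s ^ n"
      using t 1(3) by (auto intro!: power_decreasing)
    moreover have "s ^ m \<le> C * t \<or> s ^ n \<le> B * t" using g 1(4)[of g t s s'] 2(4)[of t s s'] t by auto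
    moreover have "C * t \<le> (C + B) * t" "B * t \<le> (C + B) * t" using 1(1) 2(1) t by (auto simp: algebra_simps)
    ultimately show ?thesis by linarith
  qed
  then show ?case using 1(1-3) 2(1-3)
    by (intro exI[of _ "m + n"] exI[of _ "C + B"] exI[of _ "min \<eta> \<epsilon>"]) auto
qed

lemma sgn_poly_locally_constant:
  fixes q :: "real poly"
  assumes "poly q \<sigma> \<noteq> 0 \<or> q = 0"
  shows "\<forall>\<^sub>F s in nhds \<sigma>. sgn (poly q s) = sgn (poly q \<sigma>)"
proof -
  have lim: "(poly q \<longlongrightarrow> poly q \<sigma>) (nhds \<sigma>)"
    by (rule iffD1[OF tendsto_at_iff_tendsto_nhds isContD[OF poly_isCont]])
  consider "q = 0" | "poly q \<sigma> > 0" | "poly q \<sigma> < 0" using assms by linarith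
  then show ?thesis
  proof cases
    case 1 then show ?thesis by simp
  next
    case 2
    have "\<forall>\<^sub>F s in nhds \<sigma>. 0 < poly q s" by (rule order_tendstoD(1)[OF lim 2])
    then show ?thesis by (rule eventually_mono) (use 2 in simp)
  next
    case 3
    have "\<forall>\<^sub>F s in nhds \<sigma>. poly q s < 0" by (rule order_tendstoD(2)[OF lim 3])
    then show ?thesis by (rule eventually_mono) (use 3 in simp)
  qed
qed

text \<open>Let \<open>\<sigma>\<close> be the supremum of the slice over \<open>t\<close>. If none of the describing polynomials that are nonzero
  on the slice vanished at \<open>\<sigma>\<close>, all signs would be constant near \<open>\<sigma>\<close>, so membership would not change
  across \<open>\<sigma>\<close>, which is impossible at a supremum. So \<open>\<sigma>\<close> is a zero of such a polynomial, and the
  bound for zeros applies.\<close>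

lemma sign_determined_slices_Hoelder:
  fixes S :: "(real \<times> real) set"
  assumes "sign_determined S"
    and small: "\<And>\<eta>. \<eta> > 0 \<Longrightarrow> \<exists>\<tau>>0. \<forall>t s. 0 < t \<and> t < \<tau> \<and> (t, s) \<in> S \<longrightarrow> s \<le> \<eta>"
  shows "\<exists>m C \<tau>. m > 0 \<and> C > 0 \<and> \<tau> > 0 \<and>
    (\<forall>t s. 0 < t \<and> t < \<tau> \<and> 0 < s \<and> (t, s) \<in> S \<longrightarrow> s ^ m \<le> C * t)"
proof -
  obtain F where F: "finite F" "\<forall>f\<in>F. real_polynomial_function f"
    "\<And>x y. agree_on F x y \<Longrightarrow> x \<in> S \<Longrightarrow> y \<in> S" using assms by (auto simp: sign_determined_def)
  obtain m C \<eta> where mC: "C > 0" "\<eta> > 0" "\<eta> \<le> 1"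
    "\<And>f t s s'. f \<in> F \<Longrightarrow> 0 < t \<and> t < \<eta> \<and> 0 < s \<and> s < \<eta> \<and> f (t, s) = 0 \<and> f (t, s') \<noteq> 0 \<Longrightarrow> s ^ m \<le> C * t"
    using zeros_of_polynomial_functions_Hoelder[OF F(1,2)] by metis
  obtain \<tau> where \<tau>: "\<tau> > 0" "\<And>t s. 0 < t \<and> t < \<tau> \<and> (t, s) \<in> S \<Longrightarrow> s \<le> \<eta> / 2"
    using small[of "\<eta> / 2"] mC(2) by auto
  have "s ^ Suc m \<le> C * t" if t: "0 < t \<and> t < min \<tau> \<eta> \<and> 0 < s \<and> (t, s) \<in> S" for t s
  proof -
    let ?T = "{s. (t, s) \<in> S}"
    define \<sigma> where "\<sigma> = Sup ?T"
    have bdd: "bdd_above ?T" using \<tau>(2)[of t] t by (intro bdd_aboveI[of _ "\<eta> / 2"]) auto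
    have "s \<le> \<sigma>" unfolding \<sigma>_def using bdd t by (intro cSup_upper) auto
    have "\<sigma> \<le> \<eta> / 2" unfolding \<sigma>_def using \<tau>(2)[of t] t by (intro cSup_least) auto
    have "\<exists>f\<in>F. f (t, \<sigma>) = 0 \<and> (\<exists>s'. f (t, s') \<noteq> 0)"
    proof (rule ccontr)
      assume no: "\<not> ?thesis"
      have "\<forall>\<^sub>F s in nhds \<sigma>. sgn (f (t, s)) = sgn (f (t, \<sigma>))" if f: "f \<in> F" for f
      proof -
        obtain G where G: "\<And>t s. f (t, s) = poly (poly G [:t:]) s"
          using real_polynomial_function_pair F(2) f by metis
        have "poly (poly G [:t:]) \<sigma> \<noteq> 0 \<or> poly G [:t:] = 0"
        proof -
          have "f (t, \<sigma>) \<noteq> 0 \<or> (\<forall>s'. f (t, s') = 0)" using no f by blast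
          then show ?thesis using G poly_all_0_iff_0 by metis
        qed
        then show ?thesis unfolding G by (rule sgn_poly_locally_constant)
      qed
      then have "\<forall>\<^sub>F s in nhds \<sigma>. agree_on F (t, s) (t, \<sigma>)"
        unfolding agree_on_def using F(1) by (intro eventually_ball_finite) auto
      then obtain e where e: "e > 0" "\<And>s. \<bar>s - \<sigma>\<bar> < e \<Longrightarrow> agree_on F (t, s) (t, \<sigma>)"
        by (auto simp: eventually_nhds_metric dist_real_def)
      obtain s' where s': "s' \<in> ?T" "\<sigma> - e < s'"
        using less_cSupE[of "\<sigma> - e" ?T] e(1) t unfolding \<sigma>_def by auto
      then have "s' \<le> \<sigma>" unfolding \<sigma>_def using bdd by (intro cSup_upper) auto
      then have "(t, \<sigma>) \<in> S" using F(3)[OF e(2)[of s']] s' e(1) by auto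
      then have "(t, \<sigma> + e / 2) \<in> S" using F(3)[OF agree_on_sym[OF e(2)[of "\<sigma> + e / 2"]]] e(1) by auto
      then have "\<sigma> + e / 2 \<le> \<sigma>" unfolding \<sigma>_def using bdd by (intro cSup_upper) auto
      then show False using e(1) by simp
    qed
    then obtain f s' where f: "f \<in> F" "f (t, \<sigma>) = 0" "f (t, s') \<noteq> 0" by blast
    have "\<sigma> ^ m \<le> C * t" using mC(4)[of f t \<sigma> s'] f t \<open>s \<le> \<sigma>\<close> \<open>\<sigma> \<le> \<eta> / 2\<close> mC(2) by auto
    moreover have "s ^ m \<le> \<sigma> ^ m" using \<open>s \<le> \<sigma>\<close> t by (intro power_mono) auto
    moreover have "s ^ Suc m \<le> s ^ m"
      using t \<open>s \<le> \<sigma>\<close> \<open>\<sigma> \<le> \<eta> / 2\<close> mC(2,3) by (intro power_decreasing) auto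
    ultimately show ?thesis by linarith
  qed
  then show ?thesis using mC(1,2) \<tau>(1)
    by (intro exI[of _ "Suc m"] exI[of _ C] exI[of _ "min \<tau> \<eta>"]) auto
qed

section \<open>Polynomial maps given by coefficients\<close>

lemma real_polynomial_function_poly_value:
  fixes p :: "'n::finite rpoly"
  shows "real_polynomial_function (poly_value p)"
proof -
  have "real_polynomial_function (\<lambda>x::real^'n. x $ i)" for i :: 'n
    by (intro real_polynomial_function.intros(1) bounded_linear_vec_nth)
  then show ?thesis
    unfolding poly_value_def[abs_def] monom_value_def
    by (intro real_polynomial_function_sum real_polynomial_function.intros(2,4)
        real_polynomial_function_prod real_polynomial_function_power) auto
qed

lemma sign_determined_basic_semialgebraic:
  assumes "basic_semialgebraic S"
  shows "sign_determined S"
proof -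
  obtain E G where EG: "finite E" "finite G"
    "S = {x. (\<forall>p\<in>E. poly_value p x = 0) \<and> (\<forall>p\<in>G. poly_value p x > 0)}"
    using assms by (auto simp: basic_semialgebraic_def)
  show ?thesis unfolding sign_determined_def
  proof (intro exI[of _ "poly_value ` (E \<union> G)"] conjI allI impI)
    show "finite (poly_value ` (E \<union> G))" using EG by simp
    show "\<forall>f\<in>poly_value ` (E \<union> G). real_polynomial_function f"
      using real_polynomial_function_poly_value by blast
    fix x y assume "agree_on (poly_value ` (E \<union> G)) x y" "x \<in> S"
    then have s: "sgn (poly_value p x) = sgn (poly_value p y)" if "p \<in> E \<union> G" for p
      using that by (intro agree_onD[of "poly_value ` (E \<union> G)" x y]) auto
    have "poly_value p y = 0" if "p \<in> E" for p
      using s[of p] that \<open>x \<in> S\<close> EG(3) by (auto simp: sgn_0_0)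
    moreover have "poly_value p y > 0" if "p \<in> G" for p
    proof -
      have "sgn (poly_value p x) = 1" using that \<open>x \<in> S\<close> EG(3) by auto
      then show ?thesis using s[of p] that by (simp add: sgn_1_pos)
    qed
    ultimately show "y \<in> S" using EG(3) by blast
  qed
qed

text \<open>This brings the hypothesis on \<open>K\<close> into the form to which the quantifier rules apply.\<close>

lemma sign_determined_semialgebraic:
  assumes "semialgebraic S"
  shows "sign_determined S"
proof -
  obtain \<F> where \<F>: "finite \<F>" "\<forall>T\<in>\<F>. basic_semialgebraic T" and S: "S = \<Union>\<F>"
    using assms by (auto simp: semialgebraic_def)
  from \<F> have "sign_determined (\<Union>\<F>)"
  proof (induction \<F>)
    case empty
    then show ?case by (auto simp: sign_determined_def)
  next
    case (insert T \<F>)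
    then have "sign_determined {x. x \<in> T}" "sign_determined {x. x \<in> \<Union>\<F>}"
      unfolding Collect_mem_eq using sign_determined_basic_semialgebraic[of T] by simp_all
    from sign_determined_disj[OF this] show ?case
      by (simp only: Union_insert Un_def)
  qed
  then show ?thesis using S by simp
qed

lemma poly_value_superset:
  assumes "finite A" "Poly_Mapping.keys p \<subseteq> A"
  shows "poly_value p x = (\<Sum>m\<in>A. Poly_Mapping.lookup p m * monom_value m x)"
  unfolding poly_value_def using assms
  by (intro sum.mono_neutral_left) (auto simp: in_keys_iff)

lemma poly_value_diff: "poly_value (p - q) x = poly_value p x - poly_value q x"
proof -
  let ?A = "Poly_Mapping.keys p \<union> Poly_Mapping.keys q"
  have "Poly_Mapping.keys (p - q) \<subseteq> ?A" by (rule keys_diff)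
  then show ?thesis
    using poly_value_superset[of ?A p x] poly_value_superset[of ?A q x]
      poly_value_superset[of ?A "p - q" x]
    by (simp add: lookup_minus left_diff_distrib sum_subtractf)
qed

lemma poly_map_value_diff: "poly_map_value (Q - P) x = poly_map_value Q x - poly_map_value P x"
  by (simp add: poly_map_value_def vec_eq_iff poly_value_diff)

lemma poly_degree_le_iff:
  "poly_degree p \<le> d \<longleftrightarrow> (\<forall>m\<in>Poly_Mapping.keys p. monom_degree m \<le> d)"
  unfolding poly_degree_def by (subst Max_le_iff) auto

lemma poly_maps_upto_diff:
  assumes "Q \<in> poly_maps_upto d" "P \<in> poly_maps_upto d"
  shows "Q - P \<in> poly_maps_upto d"
  using assms keys_diff by (fastforce simp: poly_maps_upto_def poly_degree_le_iff)

lemma poly_maps_upto_degree: "P \<in> poly_maps_upto (poly_map_degree P)"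
  by (auto simp: poly_maps_upto_def poly_map_degree_def intro!: Max_ge)

lemma finite_monoms_upto: "finite {m :: 'n::finite monom. monom_degree m \<le> d}"
proof -
  have "Poly_Mapping.lookup m i \<le> d" if "monom_degree m \<le> d" for m :: "'n monom" and i
    using that member_le_sum[of i UNIV "Poly_Mapping.lookup m"] by (simp add: monom_degree_def)
  then have "Poly_Mapping.lookup ` {m :: 'n monom. monom_degree m \<le> d} \<subseteq> PiE UNIV (\<lambda>_. {..d})"
    by auto
  then have "finite (Poly_Mapping.lookup ` {m :: 'n monom. monom_degree m \<le> d})"
    by (rule finite_subset) (intro finite_PiE, auto)
  then show ?thesis
    by (rule finite_imageD) (auto simp: inj_on_def lookup_inject)
qed

lemma monom_value_scaleR: "monom_value m (r *\<^sub>R v) = r ^ monom_degree m * monom_value m v"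
  by (simp add: monom_value_def monom_degree_def power_mult_distrib prod.distrib power_sum)

lemma abs_monom_value_le: "\<bar>monom_value m x\<bar> \<le> norm x ^ monom_degree m"
proof -
  have "\<bar>monom_value m x\<bar> = (\<Prod>i\<in>UNIV. \<bar>x $ i\<bar> ^ Poly_Mapping.lookup m i)"
    by (simp add: monom_value_def abs_prod power_abs)
  also have "\<dots> \<le> (\<Prod>i\<in>UNIV. norm x ^ Poly_Mapping.lookup m i)"
    by (intro prod_mono) (auto intro!: power_mono component_le_norm_cart)
  also have "\<dots> = norm x ^ monom_degree m"
    by (simp add: monom_degree_def power_sum)
  finally show ?thesis .
qed

lemma abs_lookup_le_coeff_norm: "\<bar>Poly_Mapping.lookup (Q $ l) m\<bar> \<le> coeff_norm Q"
proof (cases "m \<in> Poly_Mapping.keys (Q $ l)")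
  case True
  have "(Poly_Mapping.lookup (Q $ l) m)\<^sup>2 \<le> (\<Sum>m\<in>Poly_Mapping.keys (Q $ l). (Poly_Mapping.lookup (Q $ l) m)\<^sup>2)"
    using True by (intro member_le_sum) auto
  also have "\<dots> \<le> (\<Sum>l\<in>UNIV. \<Sum>m\<in>Poly_Mapping.keys (Q $ l). (Poly_Mapping.lookup (Q $ l) m)\<^sup>2)"
    by (rule member_le_sum[where f = "\<lambda>l. \<Sum>m\<in>Poly_Mapping.keys (Q $ l). (Poly_Mapping.lookup (Q $ l) m)\<^sup>2"])
      (auto intro!: sum_nonneg)
  finally show ?thesis unfolding coeff_norm_def by (rule real_le_rsqrt[of "\<bar>_\<bar>", simplified])
next
  case False
  then show ?thesis by (simp add: in_keys_iff coeff_norm_def sum_nonneg)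
qed

lemma coeff_norm_nonneg: "coeff_norm Q \<ge> 0"
  by (simp add: coeff_norm_def sum_nonneg)

text \<open>There are only finitely many monomials of degree at most \<open>d\<close>, and each coefficient is bounded by
  the norm of the coefficient matrix.\<close>

lemma poly_map_value_bound:
  "\<exists>C>0. \<forall>Q\<in>poly_maps_upto d. \<forall>x::real^'n::finite.
     norm (poly_map_value Q x) \<le> C * coeff_norm Q * max 1 (norm x) ^ d"
proof -
  let ?M = "{m :: 'n monom. monom_degree m \<le> d}"
  define C where "C = real CARD('n) * real (card ?M) + 1"
  have "norm (poly_map_value Q x) \<le> C * coeff_norm Q * max 1 (norm x) ^ d"
    if Q: "Q \<in> poly_maps_upto d" for Q and x :: "real^'n"
  proof -
    let ?b = "coeff_norm Q * max 1 (norm x) ^ d"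
    have b: "?b \<ge> 0" using coeff_norm_nonneg[of Q] by simp
    have "\<bar>poly_value (Q $ l) x\<bar> \<le> real (card ?M) * ?b" for l
    proof -
      have "Poly_Mapping.keys (Q $ l) \<subseteq> ?M"
        using Q by (auto simp: poly_maps_upto_def poly_degree_le_iff)
      then have "poly_value (Q $ l) x = (\<Sum>m\<in>?M. Poly_Mapping.lookup (Q $ l) m * monom_value m x)"
        by (rule poly_value_superset[OF finite_monoms_upto])
      also have "\<bar>\<dots>\<bar> \<le> (\<Sum>m\<in>?M. \<bar>Poly_Mapping.lookup (Q $ l) m * monom_value m x\<bar>)"
        by (rule sum_abs)
      also have "\<dots> \<le> (\<Sum>m\<in>?M. ?b)"
      proof (rule sum_mono)
        fix m assume m: "m \<in> ?M"
        have "\<bar>monom_value m x\<bar> \<le> norm x ^ monom_degree m" by (rule abs_monom_value_le)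
        also have "\<dots> \<le> max 1 (norm x) ^ monom_degree m" by (intro power_mono) auto
        also have "\<dots> \<le> max 1 (norm x) ^ d" using m by (intro power_increasing) auto
        finally show "\<bar>Poly_Mapping.lookup (Q $ l) m * monom_value m x\<bar> \<le> ?b"
          unfolding abs_mult by (intro mult_mono abs_lookup_le_coeff_norm coeff_norm_nonneg) auto
      qed
      finally show ?thesis by simp
    qed
    then have "(\<Sum>l\<in>UNIV. \<bar>poly_map_value Q x $ l\<bar>) \<le> (\<Sum>l\<in>(UNIV::'n set). real (card ?M) * ?b)"
      by (intro sum_mono) (simp add: poly_map_value_def)
    then have "norm (poly_map_value Q x) \<le> (real CARD('n) * real (card ?M)) * ?b"
      using norm_le_l1_cart[of "poly_map_value Q x"] by (simp add: mult.assoc)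
    also have "\<dots> \<le> C * ?b" unfolding C_def using b by (intro mult_right_mono) auto
    finally show ?thesis by (simp add: mult.assoc)
  qed
  moreover have "C > 0" unfolding C_def by (simp add: add_nonneg_pos)
  ultimately show ?thesis by blast
qed

lemma continuous_on_poly_map_value: "continuous_on A (poly_map_value P)"
  unfolding poly_map_value_def[abs_def] poly_value_def monom_value_def
  by (intro continuous_intros)

lemma lookup_homogeneous_component:
  "Poly_Mapping.lookup (homogeneous_component d p) m =
     (if monom_degree m = d then Poly_Mapping.lookup p m else 0)"
proof -
  let ?A = "{m \<in> Poly_Mapping.keys p. monom_degree m = d}"
  have "Poly_Mapping.lookup (homogeneous_component d p) m =
     (\<Sum>m'\<in>?A. if m' = m then Poly_Mapping.lookup p m' else 0)"
    unfolding homogeneous_component_def lookup_sum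
    by (intro sum.cong) (auto simp: lookup_single when_def)
  also have "\<dots> = (if m \<in> ?A then Poly_Mapping.lookup p m else 0)"
    by (subst sum.delta) auto
  finally show ?thesis by (auto simp: in_keys_iff)
qed

text \<open>Each monomial of degree \<open>e\<close> scales with \<open>r^e\<close>, so only those of degree \<open>d\<close> survive.\<close>

lemma poly_value_asymptotics:
  fixes v :: "nat \<Rightarrow> real ^ 'n::finite"
  assumes "poly_degree p \<le> d" and r: "filterlim r at_top sequentially" and v: "v \<longlonglongrightarrow> v0"
  shows "(\<lambda>k. poly_value p (r k *\<^sub>R v k) / r k ^ d) \<longlonglongrightarrow> poly_value (homogeneous_component d p) v0"
proof -
  let ?c = "Poly_Mapping.lookup p"
  have pos: "\<forall>\<^sub>F k in sequentially. r k > 0"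
    using r by (auto simp: filterlim_at_top_dense)
  have mv: "(\<lambda>k. monom_value m (v k)) \<longlonglongrightarrow> monom_value m v0" for m
    unfolding monom_value_def by (intro tendsto_intros v)
  have "(\<lambda>k. ?c m * monom_value m (r k *\<^sub>R v k) / r k ^ d) \<longlonglongrightarrow>
      Poly_Mapping.lookup (homogeneous_component d p) m * monom_value m v0"
    if m: "m \<in> Poly_Mapping.keys p" for m
  proof -
    have le: "monom_degree m \<le> d" using assms(1) m by (auto simp: poly_degree_le_iff)
    have eq: "\<forall>\<^sub>F k in sequentially. ?c m * monom_value m (v k) * inverse (r k ^ (d - monom_degree m)) =
       ?c m * monom_value m (r k *\<^sub>R v k) / r k ^ d"
      using pos
    proof eventually_elim
      case (elim k)
      have "r k ^ d = r k ^ monom_degree m * r k ^ (d - monom_degree m)"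
        using le by (simp flip: power_add)
      then show ?case using elim by (simp add: monom_value_scaleR field_simps)
    qed
    have "(\<lambda>k. ?c m * monom_value m (v k) * inverse (r k ^ (d - monom_degree m))) \<longlonglongrightarrow>
       ?c m * monom_value m v0 * (if monom_degree m = d then 1 else 0)"
    proof (intro tendsto_mult tendsto_const mv)
      show "(\<lambda>k. inverse (r k ^ (d - monom_degree m))) \<longlonglongrightarrow> (if monom_degree m = d then 1 else 0)"
      proof (cases "monom_degree m = d")
        case False
        then have "filterlim (\<lambda>k. r k ^ (d - monom_degree m)) at_top sequentially"
          using le by (intro filterlim_pow_at_top r) auto
        then show ?thesis using False by (simp add: tendsto_inverse_0_at_top)
      qed simp
    qed
    then show ?thesis using Lim_transform_eventually[OF _ eq]
      by (auto simp: lookup_homogeneous_component)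
  qed
  then have "(\<lambda>k. \<Sum>m\<in>Poly_Mapping.keys p. ?c m * monom_value m (r k *\<^sub>R v k) / r k ^ d) \<longlonglongrightarrow>
     (\<Sum>m\<in>Poly_Mapping.keys p. Poly_Mapping.lookup (homogeneous_component d p) m * monom_value m v0)"
    by (rule tendsto_sum)
  moreover have "Poly_Mapping.keys (homogeneous_component d p) \<subseteq> Poly_Mapping.keys p"
    by (auto simp: in_keys_iff lookup_homogeneous_component split: if_splits)
  ultimately show ?thesis
    by (simp add: poly_value_superset[of "Poly_Mapping.keys p" "homogeneous_component d p"]
        poly_value_def[of p] sum_divide_distrib)
qed

lemma poly_map_value_asymptotics:
  fixes v :: "nat \<Rightarrow> real ^ 'n::finite"
  assumes r: "filterlim r at_top sequentially" and v: "v \<longlonglongrightarrow> v0"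
  shows "(\<lambda>k. poly_map_value P (r k *\<^sub>R v k) /\<^sub>R r k ^ poly_map_degree P) \<longlonglongrightarrow>
     poly_map_value (leading_part P) v0"
proof (rule vec_tendstoI)
  fix l
  have "poly_degree (P $ l) \<le> poly_map_degree P"
    using poly_maps_upto_degree[of P] by (simp add: poly_maps_upto_def)
  from poly_value_asymptotics[OF this r v]
  show "(\<lambda>k. (poly_map_value P (r k *\<^sub>R v k) /\<^sub>R r k ^ poly_map_degree P) $ l) \<longlonglongrightarrow>
     poly_map_value (leading_part P) v0 $ l"
    by (simp add: poly_map_value_def leading_part_def divide_inverse mult.commute)
qed

section \<open>Existence and uniform boundedness of solutions\<close>

text \<open>Moving \<open>p\<close> slightly in the direction \<open>- v\<close> does not leave the dual cone.\<close>

lemma dual_cone_interior_pos: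
  assumes "p \<in> interior (dual_cone S)" "v \<in> S" "v \<noteq> 0"
  shows "p \<bullet> v > 0"
proof -
  obtain e where e: "e > 0" "ball p e \<subseteq> dual_cone S" using assms(1) mem_interior by blast
  define w where "w = p - (e / (2 * norm v)) *\<^sub>R v"
  have "w \<in> ball p e" using e(1) assms(3) by (simp add: w_def dist_norm)
  then have "w \<bullet> v \<ge> 0" using e(2) assms(2) by (auto simp: dual_cone_def)
  moreover have "w \<bullet> v = p \<bullet> v - e / 2 * norm v"
    using assms(3) by (simp add: w_def inner_diff_left dot_square_norm power2_eq_square)
  moreover have "e / 2 * norm v > 0" using e(1) assms(3) by simp
  ultimately show ?thesis by linarith
qed

text \<open>The points \<open>(c / t_k) x_k\<close> lie between 0 and \<open>x_k\<close> once \<open>t_k > c\<close>, hence in \<open>K\<close>,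
  and they converge to \<open>c v\<close>.\<close>

lemma asymptotic_cone_ray:
  fixes K :: "'a::real_normed_vector set"
  assumes "closed K" "convex K" "0 \<in> K" "v \<in> asymptotic_cone K" "c \<ge> 0"
  shows "c *\<^sub>R v \<in> K"
proof -
  obtain t x where t: "filterlim t at_top sequentially" and x: "\<And>k. x k \<in> K"
    and lim: "(\<lambda>k. x k /\<^sub>R t k) \<longlonglongrightarrow> v"
    using assms(4) by (auto simp: asymptotic_cone_def)
  have "\<forall>\<^sub>F k in sequentially. t k > 0" "\<forall>\<^sub>F k in sequentially. t k > c"
    using t by (auto simp: filterlim_at_top_dense)
  then have "\<forall>\<^sub>F k in sequentially. c *\<^sub>R (x k /\<^sub>R t k) \<in> K"
  proof eventually_elim
    case (elim k)
    have "(1 - c / t k) *\<^sub>R 0 + (c / t k) *\<^sub>R x k \<in> K"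
      using elim assms by (intro convexD_alt[OF assms(2,3) x]) auto
    then show ?case by (simp add: divide_inverse)
  qed
  moreover have "(\<lambda>k. c *\<^sub>R (x k /\<^sub>R t k)) \<longlonglongrightarrow> c *\<^sub>R v" by (intro tendsto_intros lim)
  ultimately show ?thesis using Lim_in_closed_set[OF assms(1)] by fastforce
qed

text \<open>Solutions on the truncated sets \<open>K \<inter> cball 0 \<rho>\<close> are included, since these are the ones that the
  fixed point argument produces. The comparison points used in the proof have norm at most that of
  the solution, hence they are available in the truncated sets as well.\<close>

lemma SOL_uniformly_bounded:
  fixes K :: "(real ^ 'n::finite) set"
  assumes K: "closed K" "convex K" "0 \<in> K"
    and d: "poly_map_degree P = d" "d > 0"
    and p: "p \<in> interior (dual_cone (SOL (asymptotic_cone K) (poly_map_value (leading_part P))))"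
  shows "\<exists>\<epsilon>>0. \<exists>R. \<forall>Q\<in>poly_maps_upto d. \<forall>q \<rho> x.
     copositive_on K (poly_map_value Q) \<and> coeff_norm (Q - P) < \<epsilon> \<and> norm (q - p) < \<epsilon> \<and>
     x \<in> SOL (K \<inter> cball 0 \<rho>) (\<lambda>x. poly_map_value Q x + q) \<longrightarrow> norm x \<le> R"
proof (rule ccontr)
  assume neg: "\<not> ?thesis"
  have "\<exists>Q q \<rho> x. Q \<in> poly_maps_upto d \<and> copositive_on K (poly_map_value Q) \<and>
      coeff_norm (Q - P) < inverse (real (Suc k)) \<and> norm (q - p) < inverse (real (Suc k)) \<and>
      x \<in> SOL (K \<inter> cball 0 \<rho>) (\<lambda>x. poly_map_value Q x + q) \<and> real (Suc k) < norm x" for k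
  proof (rule ccontr)
    assume no: "\<not> ?thesis"
    have "inverse (real (Suc k)) > 0" by simp
    with neg no show False by (meson not_le)
  qed
  then obtain Q q \<rho> x where
    Q: "\<And>k. Q k \<in> poly_maps_upto d" and cop: "\<And>k. copositive_on K (poly_map_value (Q k))"
    and cn: "\<And>k. coeff_norm (Q k - P) < inverse (real (Suc k))"
    and qp: "\<And>k. norm (q k - p) < inverse (real (Suc k))"
    and sol: "\<And>k. x k \<in> SOL (K \<inter> cball 0 (\<rho> k)) (\<lambda>x. poly_map_value (Q k) x + q k)"
    and large: "\<And>k. real (Suc k) < norm (x k)"
    by metis
  have "norm (x k) > 0" for k using large[of k] by (rule le_less_trans[rotated]) simp
  then have "\<forall>k. x k /\<^sub>R norm (x k) \<in> sphere 0 1" by simp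
  moreover have "seq_compact (sphere (0::real^'n) 1)"
    using compact_sphere compact_imp_seq_compact by blast
  ultimately obtain v0 s where v0: "v0 \<in> sphere 0 1" and s: "strict_mono s"
    and lim0: "((\<lambda>k. x k /\<^sub>R norm (x k)) \<circ> s) \<longlonglongrightarrow> v0"
    using seq_compactE[of "sphere 0 1" "\<lambda>k. x k /\<^sub>R norm (x k)"] by metis
  define r where "r = (\<lambda>k. norm (x (s k)))"
  define v where "v = (\<lambda>k. x (s k) /\<^sub>R r k)"
  have lim: "v \<longlonglongrightarrow> v0" using lim0 by (simp add: v_def r_def o_def)
  have r_ge: "real (Suc k) < r k" for k
    using large[of "s k"] seq_suble[OF s, of k] unfolding r_def by simp
  have r1: "r k > 1" "r k > 0" for k
    using r_ge[of k] of_nat_0_le_iff[of k, where 'a = real] unfolding of_nat_Suc by linarith+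
  have "real k \<le> r k" for k using r_ge[of k] by simp
  then have r_top: "filterlim r at_top sequentially"
    by (intro filterlim_at_top_mono[OF filterlim_real_sequentially] always_eventually) simp
  have xv: "x (s k) = r k *\<^sub>R v k" for k using r1[of k] by (simp add: v_def)
  have xK: "x (s k) \<in> K" "r k \<le> \<rho> (s k)" for k
    using sol[of "s k"] by (auto simp: SOL_def r_def)
  have vi: "(poly_map_value (Q (s k)) (x (s k)) + q (s k)) \<bullet> (y - x (s k)) \<ge> 0"
    if "y \<in> K" "norm y \<le> r k" for k y
    using sol[of "s k"] that xK(2)[of k] by (auto simp: SOL_def)
  have inv0: "(\<lambda>k. inverse (real (Suc (s k)))) \<longlonglongrightarrow> 0"
    using LIMSEQ_subseq_LIMSEQ[OF LIMSEQ_inverse_real_of_nat s] by (simp add: o_def)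
  have q_lim: "(\<lambda>k. q (s k)) \<longlonglongrightarrow> p"
    by (rule Lim_transform[OF tendsto_const], rule Lim_null_comparison[OF _ inv0])
      (use qp less_imp_le in \<open>auto intro!: always_eventually\<close>)
  have "norm (coeff_norm (Q (s k) - P)) \<le> inverse (real (Suc (s k)))" for k
    using cn[of "s k"] coeff_norm_nonneg[of "Q (s k) - P"] by simp
  then have cn_lim: "(\<lambda>k. coeff_norm (Q (s k) - P)) \<longlonglongrightarrow> 0"
    by (intro Lim_null_comparison[OF _ inv0] always_eventually allI)
  define w0 where "w0 = poly_map_value (leading_part P) v0"
  define G where "G = (\<lambda>k. poly_map_value (Q (s k)) (x (s k)) /\<^sub>R r k ^ d)"
  have G_lim: "G \<longlonglongrightarrow> w0"
  proof -
    have 1: "(\<lambda>k. poly_map_value P (x (s k)) /\<^sub>R r k ^ d) \<longlonglongrightarrow> w0"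
      using poly_map_value_asymptotics[OF r_top lim, of P] d(1) by (simp add: xv w0_def)
    have P: "P \<in> poly_maps_upto d" using poly_maps_upto_degree[of P] d(1) by simp
    obtain C where C: "C > 0" "\<And>Q x. Q \<in> poly_maps_upto d \<Longrightarrow>
       norm (poly_map_value Q (x::real^'n)) \<le> C * coeff_norm Q * max 1 (norm x) ^ d"
      using poly_map_value_bound by blast
    have "norm (G k - poly_map_value P (x (s k)) /\<^sub>R r k ^ d) \<le> C * coeff_norm (Q (s k) - P)" for k
    proof -
      have "norm (poly_map_value (Q (s k) - P) (x (s k))) \<le> C * coeff_norm (Q (s k) - P) * r k ^ d"
        using C(2)[OF poly_maps_upto_diff[OF Q P], of "s k" "x (s k)"] r1(1)[of k] by (simp add: r_def)
      moreover have "G k - poly_map_value P (x (s k)) /\<^sub>R r k ^ d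
          = poly_map_value (Q (s k) - P) (x (s k)) /\<^sub>R r k ^ d"
        by (simp add: G_def poly_map_value_diff scaleR_diff_right)
      ultimately show ?thesis using r1(2)[of k] by (simp add: field_simps)
    qed
    then have "(\<lambda>k. G k - poly_map_value P (x (s k)) /\<^sub>R r k ^ d) \<longlonglongrightarrow> 0"
      by (rule Lim_null_comparison[OF always_eventually[OF allI] tendsto_mult_right_zero[OF cn_lim]])
    from Lim_transform[OF 1 this] show ?thesis .
  qed
  have v0_cone: "v0 \<in> asymptotic_cone K"
    unfolding asymptotic_cone_def mem_Collect_eq
    by (intro exI[of _ r] exI[of _ "\<lambda>k. x (s k)"] conjI allI r_top xK(1) lim[unfolded v_def])
  \<comment> \<open>Comparison with the point 0 of K, using copositivity.\<close>
  have "q (s k) \<bullet> v k \<le> 0" for k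
  proof -
    have "poly_map_value (Q (s k)) (x (s k)) \<bullet> x (s k) \<ge> 0"
      using cop xK(1) by (auto simp: copositive_on_def)
    then have "q (s k) \<bullet> x (s k) \<le> 0"
      using vi[OF K(3), of k] r1[of k] by (simp add: inner_add_left)
    then show ?thesis using r1(2)[of k] by (simp add: xv mult_le_0_iff)
  qed
  then have pv: "p \<bullet> v0 \<le> 0"
    by (intro LIMSEQ_le_const2[OF tendsto_inner[OF q_lim lim]]) auto
  have "G k \<bullet> v k \<ge> 0" for k
  proof -
    have "poly_map_value (Q (s k)) (x (s k)) \<bullet> x (s k) \<ge> 0"
      using cop xK(1) by (auto simp: copositive_on_def)
    then show ?thesis using r1(2)[of k] by (simp add: G_def v_def)
  qed
  then have wv: "w0 \<bullet> v0 \<ge> 0"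
    by (intro LIMSEQ_le_const[OF tendsto_inner[OF G_lim lim]]) auto
  have q0: "(\<lambda>k. q (s k) /\<^sub>R r k ^ d) \<longlonglongrightarrow> 0"
  proof -
    have "filterlim (\<lambda>k. r k ^ d) at_top sequentially" using d(2) by (intro filterlim_pow_at_top r_top) auto
    then have "(\<lambda>k. inverse (r k ^ d)) \<longlonglongrightarrow> 0" by (rule tendsto_inverse_0_at_top)
    from tendsto_scaleR[OF this q_lim] show ?thesis by simp
  qed
  \<comment> \<open>Comparison with r_k a w, which lies in K because the asymptotic cone consists of rays of K.\<close>
  have w_unit: "w0 \<bullet> (a *\<^sub>R w - v0) \<ge> 0"
    if w: "w \<in> asymptotic_cone K" and a: "a \<ge> 0" "norm (a *\<^sub>R w) \<le> 1" for a w
  proof -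
    have "(G k + q (s k) /\<^sub>R r k ^ d) \<bullet> (a *\<^sub>R w - v k) \<ge> 0" for k
    proof -
      have "(r k * a) *\<^sub>R w \<in> K" using asymptotic_cone_ray[OF K w] a r1(2)[of k] by simp
      moreover have "norm ((r k * a) *\<^sub>R w) \<le> r k"
        using mult_left_mono[OF a(2), of "r k"] r1(2)[of k] a by (simp add: abs_mult mult.assoc)
      ultimately have *: "(poly_map_value (Q (s k)) (x (s k)) + q (s k)) \<bullet> ((r k * a) *\<^sub>R w - x (s k)) \<ge> 0"
        by (rule vi)
      have "(r k * a) *\<^sub>R w - x (s k) = r k *\<^sub>R (a *\<^sub>R w - v k)"
        by (simp add: xv scaleR_diff_right)
      then have "(poly_map_value (Q (s k)) (x (s k)) + q (s k)) \<bullet> (a *\<^sub>R w - v k) \<ge> 0"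
        using * r1(2)[of k] by (simp add: zero_le_mult_iff)
      moreover have "G k + q (s k) /\<^sub>R r k ^ d = (poly_map_value (Q (s k)) (x (s k)) + q (s k)) /\<^sub>R r k ^ d"
        by (simp add: G_def scaleR_add_right)
      ultimately show ?thesis using r1(2)[of k] by simp
    qed
    moreover have "(\<lambda>k. (G k + q (s k) /\<^sub>R r k ^ d) \<bullet> (a *\<^sub>R w - v k)) \<longlonglongrightarrow> (w0 + 0) \<bullet> (a *\<^sub>R w - v0)"
      by (intro tendsto_intros G_lim q0 lim)
    ultimately show ?thesis using LIMSEQ_le_const[of _ "(w0 + 0) \<bullet> (a *\<^sub>R w - v0)" 0] by auto
  qed
  \<comment> \<open>Once w0 is orthogonal to v0, the inequality for w does not depend on the length of w.\<close>
  have wv0: "w0 \<bullet> v0 = 0" using w_unit[OF v0_cone, of 0] wv by simp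
  have "w0 \<bullet> (w - v0) \<ge> 0" if w: "w \<in> asymptotic_cone K" for w
  proof (cases "w = 0")
    case True then show ?thesis using wv0 by simp
  next
    case False
    then have "w0 \<bullet> ((1 / norm w) *\<^sub>R w - v0) \<ge> 0" by (intro w_unit[OF w]) auto
    then show ?thesis using wv0 False by (simp add: inner_diff_right zero_le_divide_iff)
  qed
  then have "v0 \<in> SOL (asymptotic_cone K) (poly_map_value (leading_part P))"
    using v0_cone by (simp add: SOL_def w0_def)
  moreover have "v0 \<noteq> 0" using v0 by auto
  ultimately have "p \<bullet> v0 > 0" using dual_cone_interior_pos[OF p] by blast
  then show False using pv by simp
qed

text \<open>A fixed point of \<open>x \<mapsto> proj (x - F x)\<close>, where \<open>proj\<close> is the projection onto \<open>C\<close>, solves the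
  variational inequality: this is the angle criterion for closest points.\<close>

lemma SOL_compact_convex_nonempty:
  fixes C :: "'a::euclidean_space set"
  assumes "compact C" "convex C" "C \<noteq> {}" "continuous_on C F"
  shows "SOL C F \<noteq> {}"
proof -
  have cl: "closed C" using assms(1) compact_imp_closed by blast
  let ?f = "\<lambda>x. closest_point C (x - F x)"
  have "continuous_on C (closest_point C \<circ> (\<lambda>x. x - F x))"
    by (rule continuous_on_compose)
      (use assms cl in \<open>auto intro!: continuous_intros continuous_on_closest_point\<close>)
  then have "continuous_on C ?f" by (simp add: o_def)
  moreover have "?f \<in> C \<rightarrow> C" using closest_point_in_set[OF cl assms(3)] by auto
  ultimately obtain x where x: "x \<in> C" "?f x = x" using brouwer[OF assms(1-3)] by blast
  have "F x \<bullet> (y - x) \<ge> 0" if "y \<in> C" for y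
    using closest_point_dot[OF assms(2) cl that, of "x - F x"] x(2) by simp
  then show ?thesis using x(1) by (auto simp: SOL_def)
qed

text \<open>From a point inside the ball one can move a little towards any \<open>y\<close> in \<open>K\<close>, and the inequality is
  linear along the segment.\<close>

lemma SOL_localize:
  fixes K :: "'a::real_inner set"
  assumes "convex K" "x \<in> SOL (K \<inter> cball 0 \<rho>) F" "norm x < \<rho>"
  shows "x \<in> SOL K F"
proof -
  have xK: "x \<in> K" using assms(2) by (simp add: SOL_def)
  have "F x \<bullet> (y - x) \<ge> 0" if "y \<in> K" for y
  proof -
    define l where "l = min 1 ((\<rho> - norm x) / (norm (y - x) + 1))"
    have pos: "norm (y - x) + 1 > 0" by (simp add: add_nonneg_pos)
    have l: "0 < l" "l \<le> 1" using assms(3) pos by (auto simp: l_def)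
    have "l * norm (y - x) \<le> l * (norm (y - x) + 1)" using l by (intro mult_left_mono) auto
    also have "\<dots> \<le> (\<rho> - norm x) / (norm (y - x) + 1) * (norm (y - x) + 1)"
      using pos by (intro mult_right_mono) (auto simp: l_def)
    also have "\<dots> = \<rho> - norm x" using pos by simp
    finally have "l * norm (y - x) \<le> \<rho> - norm x" .
    then have "norm (x + l *\<^sub>R (y - x)) \<le> \<rho>"
      using norm_triangle_ineq[of x "l *\<^sub>R (y - x)"] l by simp
    moreover have "(1 - l) *\<^sub>R x + l *\<^sub>R y \<in> K" using convexD_alt[OF assms(1) xK that] l by simp
    ultimately have "x + l *\<^sub>R (y - x) \<in> K \<inter> cball 0 \<rho>" by (simp add: algebra_simps)
    then have "F x \<bullet> (x + l *\<^sub>R (y - x) - x) \<ge> 0" using assms(2) unfolding SOL_def by blast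
    then show ?thesis using l by (simp add: zero_le_mult_iff)
  qed
  then show ?thesis using xK by (simp add: SOL_def)
qed

section \<open>Hoelder error bound for approximate solutions\<close>

lemma real_polynomial_function_inner:
  fixes f g :: "'x::real_normed_vector \<Rightarrow> 'a::euclidean_space"
  assumes "polynomial_function f" "polynomial_function g"
  shows "real_polynomial_function (\<lambda>x. f x \<bullet> g x)"
proof -
  have *: "real_polynomial_function (\<lambda>x. h x \<bullet> b)" if "polynomial_function h" for h :: "'x \<Rightarrow> 'a" and b
    using polynomial_function_inner[OF that] by (simp add: real_polynomial_function_eq)
  show ?thesis
    by (subst euclidean_inner)
      (intro real_polynomial_function_sum real_polynomial_function.intros(4) * assms finite_Basis)
qed

text \<open>The tolerance \<open>1 + \<bar>y - x\<bar>\<^sup>2\<close> dominates \<open>\<bar>y - x\<bar>\<close>, so that perturbed solutions qualify, and it is polynomial,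
  so that the set is definable together with the parameter \<open>t\<close>.\<close>

definition approx_SOL :: "'a::real_inner set \<Rightarrow> ('a \<Rightarrow> 'a) \<Rightarrow> real \<Rightarrow> real \<Rightarrow> 'a set" where
  "approx_SOL K F R t =
     {x \<in> K. norm x \<le> R \<and> (\<forall>y\<in>K. 0 \<le> F x \<bullet> (y - x) + t * (1 + (y - x) \<bullet> (y - x)))}"

lemma approx_SOL_0: "approx_SOL K F R 0 = SOL K F \<inter> cball 0 R"
  by (auto simp: approx_SOL_def SOL_def)

lemma sign_determined_approx_SOL:
  fixes K :: "'a::euclidean_space set"
  assumes K: "sign_determined K" and F: "polynomial_function F" and "R \<ge> 0"
  shows "sign_determined {z. snd z \<in> approx_SOL K F R (fst z)}"
proof -
  let ?x = "\<lambda>w::(real \<times> 'a) \<times> 'a. snd (fst w)"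
  have x: "polynomial_function ?x"
    by (intro polynomial_function_bounded_linear bounded_linear_compose[OF bounded_linear_snd bounded_linear_fst])
  have t: "real_polynomial_function (\<lambda>w::(real \<times> 'a) \<times> 'a. fst (fst w))"
    by (intro real_polynomial_function.intros(1) bounded_linear_compose[OF bounded_linear_fst bounded_linear_fst])
  have y: "polynomial_function (\<lambda>w::(real \<times> 'a) \<times> 'a. snd w - ?x w)"
    by (intro polynomial_function_diff x polynomial_function_bounded_linear bounded_linear_snd)
  have "sign_determined {w. snd w \<in> K}"
    by (intro sign_determined_vimage K polynomial_function_bounded_linear bounded_linear_snd)
  moreover have "real_polynomial_function (\<lambda>w. F (?x w) \<bullet> (snd w - ?x w) +
      fst (fst w) * (1 + (snd w - ?x w) \<bullet> (snd w - ?x w)))"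
    by (intro real_polynomial_function.intros(2,3,4) t
        real_polynomial_function_inner y polynomial_function_compose[OF x F, unfolded o_def])
  ultimately have "sign_determined {w. snd w \<in> K \<longrightarrow>
     0 \<le> F (?x w) \<bullet> (snd w - ?x w) + fst (fst w) * (1 + (snd w - ?x w) \<bullet> (snd w - ?x w))}"
    by (intro sign_determined_imp sign_determined_nonneg)
  then have A: "sign_determined {z::real \<times> 'a. \<forall>y. y \<in> K \<longrightarrow>
     0 \<le> F (snd z) \<bullet> (y - snd z) + fst z * (1 + (y - snd z) \<bullet> (y - snd z))}"
    by (rule sign_determined_all)
  have B: "sign_determined {z::real \<times> 'a. snd z \<in> K}"
    by (intro sign_determined_vimage K polynomial_function_bounded_linear bounded_linear_snd)
  have "real_polynomial_function (\<lambda>z::real \<times> 'a. R\<^sup>2 - snd z \<bullet> snd z)"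
    by (intro real_polynomial_function_diff real_polynomial_function.intros(2)
        real_polynomial_function_inner polynomial_function_bounded_linear bounded_linear_snd)
  then have C: "sign_determined {z::real \<times> 'a. 0 \<le> R\<^sup>2 - snd z \<bullet> snd z}"
    by (rule sign_determined_nonneg)
  have "norm x \<le> R \<longleftrightarrow> 0 \<le> R\<^sup>2 - x \<bullet> x" for x :: 'a
    using \<open>R \<ge> 0\<close> by (simp add: norm_le_square)
  then have "{z. snd z \<in> approx_SOL K F R (fst z)} = {z. snd z \<in> K \<and> 0 \<le> R\<^sup>2 - snd z \<bullet> snd z \<and>
     (\<forall>y. y \<in> K \<longrightarrow> 0 \<le> F (snd z) \<bullet> (y - snd z) + fst z * (1 + (y - snd z) \<bullet> (y - snd z)))}"
    unfolding approx_SOL_def by auto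
  then show ?thesis using sign_determined_conj[OF B sign_determined_conj[OF C A]] by simp
qed

text \<open>This limit property serves twice: it shows that the solutions in the ball form a closed set, and it
  makes limits of approximate solutions with vanishing tolerance exact solutions.\<close>

lemma approx_SOL_limit:
  fixes K :: "'a::euclidean_space set"
  assumes "closed K" "continuous_on UNIV F" and t: "t \<longlonglongrightarrow> 0"
    and x: "\<And>k. x k \<in> approx_SOL K F R (t k)" "x \<longlonglongrightarrow> l"
  shows "l \<in> approx_SOL K F R 0"
proof -
  have "l \<in> K" using x by (intro closed_sequentially[OF assms(1) _ x(2)]) (auto simp: approx_SOL_def)
  moreover have "norm l \<le> R"
    by (rule LIMSEQ_le_const2[OF tendsto_norm[OF x(2)]]) (use x in \<open>auto simp: approx_SOL_def\<close>)
  moreover have "0 \<le> F l \<bullet> (y - l) + 0 * (1 + (y - l) \<bullet> (y - l))" if y: "y \<in> K" for y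
  proof (rule LIMSEQ_le_const)
    have "(\<lambda>k. F (x k)) \<longlonglongrightarrow> F l"
      by (rule continuous_on_tendsto_compose[OF assms(2) x(2)]) auto
    then show "(\<lambda>k. F (x k) \<bullet> (y - x k) + t k * (1 + (y - x k) \<bullet> (y - x k))) \<longlonglongrightarrow>
        F l \<bullet> (y - l) + 0 * (1 + (y - l) \<bullet> (y - l))"
      by (intro tendsto_intros x(2) t)
    show "\<exists>N. \<forall>n\<ge>N. 0 \<le> F (x n) \<bullet> (y - x n) + t n * (1 + (y - x n) \<bullet> (y - x n))"
      using x(1) y by (auto simp: approx_SOL_def)
  qed
  ultimately show ?thesis by (simp add: approx_SOL_def)
qed

text \<open>Apply the decay of planar slices to the pairs \<open>(t, s)\<close> such that some point of \<open>approx_SOL K F R t\<close> has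
  squared distance at least \<open>s\<close> from all of \<open>approx_SOL K F R 0\<close>. The square makes the condition
  polynomial, which is why \<open>2 m\<close> appears in the exponent.\<close>

lemma approx_SOL_Hoelder:
  fixes K :: "'a::euclidean_space set"
  assumes K: "closed K" "sign_determined K" and F: "polynomial_function F"
    and R: "R \<ge> 0" and ne: "approx_SOL K F R 0 \<noteq> {}"
  shows "\<exists>L c \<tau>. L > 0 \<and> c > 0 \<and> \<tau> > 0 \<and> (\<forall>t x. 0 < t \<and> t < \<tau> \<and> x \<in> approx_SOL K F R t \<longrightarrow>
     (\<exists>z\<in>approx_SOL K F R 0. norm (x - z) \<le> L * t powr c))"
proof -
  let ?E = "approx_SOL K F R"
  have cont: "continuous_on UNIV F" using F by (rule continuous_on_polymonial_function)
  define S where "S = {w. \<exists>x. x \<in> ?E (fst w) \<and> (\<forall>z. z \<in> ?E 0 \<longrightarrow> snd w \<le> (x - z) \<bullet> (x - z))}"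
  have "sign_determined S"
  proof -
    note E = sign_determined_approx_SOL[OF K(2) F R]
    let ?x = "\<lambda>w::((real \<times> real) \<times> 'a) \<times> 'a. snd (fst w)"
    have lin: "bounded_linear ?x"
      by (intro bounded_linear_compose[OF bounded_linear_snd bounded_linear_fst])
    have s: "bounded_linear (\<lambda>w::((real \<times> real) \<times> 'a) \<times> 'a. snd (fst (fst w)))"
      by (intro bounded_linear_compose[OF bounded_linear_snd]
          bounded_linear_compose[OF bounded_linear_fst bounded_linear_fst])
    have 1: "sign_determined {w::((real \<times> real) \<times> 'a) \<times> 'a. snd w \<in> ?E 0}"
    proof -
      have "polynomial_function (\<lambda>w::((real \<times> real) \<times> 'a) \<times> 'a. (0::real, snd w))"
        by (intro polynomial_function_bounded_linear bounded_linear_Pair bounded_linear_zero bounded_linear_snd)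
      from sign_determined_vimage[OF E this] show ?thesis by simp
    qed
    have diff: "polynomial_function (\<lambda>w::((real \<times> real) \<times> 'a) \<times> 'a. ?x w - snd w)"
      by (intro polynomial_function_diff polynomial_function_bounded_linear lin bounded_linear_snd)
    have "real_polynomial_function (\<lambda>w::((real \<times> real) \<times> 'a) \<times> 'a.
        (?x w - snd w) \<bullet> (?x w - snd w) - snd (fst (fst w)))"
      by (intro real_polynomial_function_diff real_polynomial_function_inner diff
          real_polynomial_function.intros(1)[OF s])
    from sign_determined_imp[OF 1 sign_determined_nonneg[OF this]]
    have 2: "sign_determined {v::(real \<times> real) \<times> 'a. \<forall>z. z \<in> ?E 0 \<longrightarrow>
        0 \<le> (snd v - z) \<bullet> (snd v - z) - snd (fst v)}"
      by (rule sign_determined_all)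
    have 3: "sign_determined {v::(real \<times> real) \<times> 'a. snd v \<in> ?E (fst (fst v))}"
    proof -
      have "polynomial_function (\<lambda>v::(real \<times> real) \<times> 'a. (fst (fst v), snd v))"
        by (intro polynomial_function_bounded_linear bounded_linear_Pair bounded_linear_snd
            bounded_linear_compose[OF bounded_linear_fst bounded_linear_fst])
      from sign_determined_vimage[OF E this] show ?thesis by simp
    qed
    from sign_determined_ex[OF sign_determined_conj[OF 3 2]]
    show ?thesis by (simp add: S_def)
  qed
  moreover have "\<exists>\<tau>>0. \<forall>t s. 0 < t \<and> t < \<tau> \<and> (t, s) \<in> S \<longrightarrow> s \<le> \<eta>" if \<eta>: "\<eta> > 0" for \<eta>
  proof (rule ccontr)
    assume no: "\<not> ?thesis"
    have "\<exists>t s x. 0 < t \<and> t < inverse (real (Suc k)) \<and> \<eta> < s \<and> x \<in> ?E t \<and>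
        (\<forall>z\<in>?E 0. s \<le> (x - z) \<bullet> (x - z))" for k
    proof -
      have "inverse (real (Suc k)) > 0" by simp
      with no obtain t s where "0 < t" "t < inverse (real (Suc k))" "(t, s) \<in> S" "\<eta> < s"
        by (meson not_le)
      then show ?thesis unfolding S_def by auto
    qed
    then obtain t s x where t: "\<And>k. 0 < t k" "\<And>k. t k < inverse (real (Suc k))"
      and s: "\<And>k. \<eta> < s k" and x: "\<And>k. x k \<in> ?E (t k)"
      and far: "\<And>k z. z \<in> ?E 0 \<Longrightarrow> s k \<le> (x k - z) \<bullet> (x k - z)"
      by metis
    have "\<forall>k. x k \<in> cball 0 R" using x by (simp add: approx_SOL_def)
    moreover have "seq_compact (cball (0::'a) R)" using compact_cball compact_imp_seq_compact by blast
    ultimately obtain l r where r: "strict_mono r" and l: "(x \<circ> r) \<longlonglongrightarrow> l"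
      using seq_compactE[of "cball 0 R" x] by metis
    have "norm (t k) \<le> inverse (real (Suc k))" for k using t(1)[of k] t(2)[of k] by simp
    then have "t \<longlonglongrightarrow> 0"
      by (rule Lim_null_comparison[OF always_eventually[OF allI] LIMSEQ_inverse_real_of_nat])
    then have "(t \<circ> r) \<longlonglongrightarrow> 0" by (rule LIMSEQ_subseq_LIMSEQ[OF _ r])
    then have "l \<in> ?E 0" using l x by (intro approx_SOL_limit[OF K(1) cont]) auto
    then have "\<eta> \<le> ((x \<circ> r) k - l) \<bullet> ((x \<circ> r) k - l)" for k
      using far[of l "r k"] s[of "r k"] by simp
    moreover have "(\<lambda>k. ((x \<circ> r) k - l) \<bullet> ((x \<circ> r) k - l)) \<longlonglongrightarrow> (l - l) \<bullet> (l - l)"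
      by (intro tendsto_intros l)
    ultimately have "\<eta> \<le> (l - l) \<bullet> (l - l)" by (intro LIMSEQ_le_const) auto
    then show False using \<eta> by simp
  qed
  ultimately obtain m C \<tau> where m: "m > 0" "C > 0" "\<tau> > 0"
    "\<And>t s. 0 < t \<Longrightarrow> t < \<tau> \<Longrightarrow> 0 < s \<Longrightarrow> (t, s) \<in> S \<Longrightarrow> s ^ m \<le> C * t"
    using sign_determined_slices_Hoelder[of S] by metis
  have closed: "closed (?E 0)"
    unfolding closed_sequential_limits
  proof (intro allI impI, elim conjE)
    fix x l assume "\<forall>n. x n \<in> ?E 0" "x \<longlonglongrightarrow> l"
    then show "l \<in> ?E 0" using approx_SOL_limit[OF K(1) cont tendsto_const[of 0], of x R l] by blast
  qed
  define c where "c = 1 / real (2 * m)"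
  have "\<exists>z\<in>?E 0. norm (x - z) \<le> C powr c * t powr c" if t: "0 < t \<and> t < \<tau> \<and> x \<in> ?E t" for t x
  proof -
    obtain z where z: "z \<in> ?E 0" "\<And>y. y \<in> ?E 0 \<Longrightarrow> dist x z \<le> dist x y"
      using distance_attains_inf[OF closed ne] by blast
    show ?thesis
    proof (cases "x = z")
      case True
      then show ?thesis using z(1) by (intro bexI[of _ z]) auto
    next
      case False
      let ?n = "norm (x - z)"
      have pos: "?n > 0" using False by simp
      have "?n\<^sup>2 \<le> (x - y) \<bullet> (x - y)" if "y \<in> ?E 0" for y
        using z(2)[OF that] by (simp add: dist_norm dot_square_norm power_mono)
      then have "(t, ?n\<^sup>2) \<in> S" using t unfolding S_def by auto
      then have "(?n\<^sup>2) ^ m \<le> C * t" using m(4)[of t "?n\<^sup>2"] t pos by simp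
      then have le: "?n ^ (2 * m) \<le> C * t" by (simp add: power_mult)
      have "?n = root (2 * m) (?n ^ (2 * m))" using m(1) pos by (simp add: real_root_power_cancel)
      also have "\<dots> \<le> root (2 * m) (C * t)" using le m(1) by (intro real_root_le_mono) auto
      also have "\<dots> = (C * t) powr c" unfolding c_def using m(1,2) t by (subst root_powr_inverse) auto
      also have "\<dots> = C powr c * t powr c" using m(2) t by (simp add: powr_mult)
      finally show ?thesis using z(1) by blast
    qed
  qed
  moreover have "c > 0" using m(1) by (simp add: c_def)
  moreover have "C powr c > 0" using m(2) by simp
  ultimately show ?thesis using m(3) by blast
qed

section \<open>Stability of the solution set\<close>

lemma polynomial_function_poly_map_value: "polynomial_function (poly_map_value P)"
proof -
  have "real_polynomial_function (\<lambda>x. poly_map_value P x \<bullet> b)" if b: "b \<in> Basis" for b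
  proof -
    obtain i where "b = axis i 1" using b by (auto simp: Basis_vec_def)
    then show ?thesis
      using real_polynomial_function_poly_value[of "P $ i"] by (simp add: inner_axis poly_map_value_def)
  qed
  then show ?thesis by (simp add: polynomial_function_iff_Basis_inner)
qed

text \<open>Replacing \<open>G\<close> by \<open>F\<close> costs at most \<open>t \<bar>y - x\<bar>\<close>, by the Cauchy-Schwarz inequality.\<close>

lemma SOL_perturbed_subset_approx_SOL:
  assumes x: "x \<in> SOL K G" and R: "norm x \<le> R" and t: "norm (F x - G x) \<le> t"
  shows "x \<in> approx_SOL K F R t"
proof -
  have "0 \<le> F x \<bullet> (y - x) + t * (1 + (y - x) \<bullet> (y - x))" if y: "y \<in> K" for y
  proof -
    let ?n = "norm (y - x)"
    have "0 \<le> (?n - 1)\<^sup>2" by simp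
    then have "?n \<le> 1 + ?n\<^sup>2" by (simp add: power2_diff) (smt (verit) zero_le_power2)
    then have "norm (F x - G x) * ?n \<le> t * (1 + ?n\<^sup>2)"
      using t by (intro mult_mono) (auto intro: order_trans[OF norm_ge_zero])
    moreover have "- ((F x - G x) \<bullet> (y - x)) \<le> norm (F x - G x) * ?n"
      using Cauchy_Schwarz_ineq2[of "F x - G x" "y - x"] by linarith
    moreover have "G x \<bullet> (y - x) \<ge> 0" using x y by (auto simp: SOL_def)
    ultimately show ?thesis by (simp add: inner_diff_left dot_square_norm)
  qed
  then show ?thesis using x R by (auto simp: approx_SOL_def SOL_def)
qed

theorem theorem4p3:
  fixes K :: "(real ^ 'n::finite) set"
    and P :: "'n poly_map"
    and d :: nat
    and p :: "real ^ 'n"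
  assumes "K \<noteq> {}" and "closed K" and "convex K"
    and "poly_map_degree P = d" and "d > 0"
    and "semialgebraic K" and "0 \<in> K"
    and "copositive_on K (poly_map_value P)"
    and "p \<in> interior (dual_cone (SOL (asymptotic_cone K) (poly_map_value (leading_part P))))"
  shows "\<exists>\<epsilon> L c :: real. \<epsilon> > 0 \<and> L > 0 \<and> c > 0 \<and>
    (\<forall>Q \<in> poly_maps_upto d. \<forall>q :: real ^ 'n.
       copositive_on K (poly_map_value Q) \<and> max (coeff_norm (Q - P)) (norm (q - p)) < \<epsilon> \<longrightarrow>
         SOL K (\<lambda>x. poly_map_value Q x + q) \<noteq> {} \<and>
         bounded (SOL K (\<lambda>x. poly_map_value Q x + q)) \<and>
         SOL K (\<lambda>x. poly_map_value Q x + q) \<subseteq>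
           {x + (L * (coeff_norm (Q - P) + norm (q - p)) powr c) *\<^sub>R u | x u.
              x \<in> SOL K (\<lambda>x. poly_map_value P x + p) \<and> u \<in> cball 0 1})"
proof -
  note K = \<open>closed K\<close> \<open>convex K\<close> \<open>0 \<in> K\<close>
  obtain \<epsilon>0 R0 where \<epsilon>0: "\<epsilon>0 > 0" and R0: "\<And>Q q \<rho> x. Q \<in> poly_maps_upto d \<Longrightarrow>
     copositive_on K (poly_map_value Q) \<Longrightarrow> coeff_norm (Q - P) < \<epsilon>0 \<Longrightarrow> norm (q - p) < \<epsilon>0 \<Longrightarrow>
     x \<in> SOL (K \<inter> cball 0 \<rho>) (\<lambda>x. poly_map_value Q x + q) \<Longrightarrow> norm x \<le> R0"
    using SOL_uniformly_bounded[OF K assms(4,5,9)] by metis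
  define R where "R = max R0 0"
  have bound: "norm x \<le> R"
    if "Q \<in> poly_maps_upto d" "copositive_on K (poly_map_value Q)"
       "coeff_norm (Q - P) < \<epsilon>0" "norm (q - p) < \<epsilon>0" "x \<in> SOL K (\<lambda>x. poly_map_value Q x + q)" for Q q x
  proof -
    have "x \<in> SOL (K \<inter> cball 0 (norm x)) (\<lambda>x. poly_map_value Q x + q)"
      using that(5) by (auto simp: SOL_def)
    then show ?thesis using R0 that unfolding R_def by (meson max.coboundedI1)
  qed
  have nonempty: "SOL K (\<lambda>x. poly_map_value Q x + q) \<noteq> {}"
    if "Q \<in> poly_maps_upto d" "copositive_on K (poly_map_value Q)"
       "coeff_norm (Q - P) < \<epsilon>0" "norm (q - p) < \<epsilon>0" for Q q
  proof -
    let ?C = "K \<inter> cball 0 (R + 1)"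
    have "compact ?C" using K(1) by (simp add: closed_Int_compact)
    moreover have "convex ?C" using K(2) by (simp add: convex_Int)
    moreover have "?C \<noteq> {}" using K(3) by (auto simp: R_def)
    moreover have "continuous_on ?C (\<lambda>x. poly_map_value Q x + q)"
      by (intro continuous_intros continuous_on_poly_map_value)
    ultimately obtain x where x: "x \<in> SOL ?C (\<lambda>x. poly_map_value Q x + q)"
      using SOL_compact_convex_nonempty by blast
    then have "norm x \<le> R0" using R0 that by blast
    then have "norm x < R + 1" by (simp add: R_def)
    then show ?thesis using SOL_localize[OF K(2) x] by blast
  qed
  define F where "F = (\<lambda>x. poly_map_value P x + p)"
  have P: "P \<in> poly_maps_upto d" using poly_maps_upto_degree[of P] assms(4) by simp
  have cn0: "coeff_norm (P - P) = 0" by (simp add: coeff_norm_def)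
  have "SOL K F \<noteq> {}" "\<And>x. x \<in> SOL K F \<Longrightarrow> norm x \<le> R"
    unfolding F_def
    using nonempty[OF P assms(8), of p] bound[OF P assms(8), of p] \<epsilon>0 cn0 by simp_all
  then have ne: "approx_SOL K F R 0 \<noteq> {}" unfolding approx_SOL_0 by auto
  have F: "polynomial_function F"
    unfolding F_def by (intro polynomial_function_add polynomial_function_poly_map_value polynomial_function_const)
  have "R \<ge> 0" by (simp add: R_def)
  then obtain L c \<tau> where L: "L > 0" "c > 0" "\<tau> > 0"
    "\<And>t x. 0 < t \<Longrightarrow> t < \<tau> \<Longrightarrow> x \<in> approx_SOL K F R t \<Longrightarrow>
       \<exists>z\<in>approx_SOL K F R 0. norm (x - z) \<le> L * t powr c"
    using approx_SOL_Hoelder[OF K(1) sign_determined_semialgebraic[OF assms(6)] F _ ne] by metis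
  obtain C where C: "C > 0" "\<And>Q x. Q \<in> poly_maps_upto d \<Longrightarrow>
       norm (poly_map_value Q (x::real^'n)) \<le> C * coeff_norm Q * max 1 (norm x) ^ d"
    using poly_map_value_bound by blast
  define B where "B = C * max 1 R ^ d + 1"
  have B: "B > 0" using C(1) by (simp add: B_def add_pos_pos)
  \<comment> \<open>The size of the perturbation, a sum of two terms below epsilon, is multiplied by B and must
    stay below tau.\<close>
  define \<epsilon> where "\<epsilon> = min \<epsilon>0 (\<tau> / (2 * B))"
  have "SOL K (\<lambda>x. poly_map_value Q x + q) \<noteq> {} \<and>
         bounded (SOL K (\<lambda>x. poly_map_value Q x + q)) \<and>
         SOL K (\<lambda>x. poly_map_value Q x + q) \<subseteq>
           {x + (L * B powr c * (coeff_norm (Q - P) + norm (q - p)) powr c) *\<^sub>R u | x u.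
              x \<in> SOL K F \<and> u \<in> cball 0 1}"
    if Q: "Q \<in> poly_maps_upto d" "copositive_on K (poly_map_value Q)"
      "max (coeff_norm (Q - P)) (norm (q - p)) < \<epsilon>" for Q q
  proof (intro conjI subsetI)
    let ?G = "\<lambda>x. poly_map_value Q x + q"
    have small: "coeff_norm (Q - P) < \<epsilon>0" "norm (q - p) < \<epsilon>0"
      using Q(3) by (auto simp: \<epsilon>_def)
    note bnd = bound[OF Q(1,2) small]
    show "SOL K ?G \<noteq> {}" by (rule nonempty[OF Q(1,2) small])
    show "bounded (SOL K ?G)" using bnd by (auto simp: bounded_iff)
    fix x assume x: "x \<in> SOL K ?G"
    define \<delta> where "\<delta> = coeff_norm (Q - P) + norm (q - p)"
    have "norm (F x - ?G x) \<le> B * \<delta>"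
    proof -
      have "norm (F x - ?G x) = norm (poly_map_value (Q - P) x + (q - p))"
        by (simp add: F_def poly_map_value_diff norm_minus_commute algebra_simps)
      also have "\<dots> \<le> norm (poly_map_value (Q - P) x) + norm (q - p)" by (rule norm_triangle_ineq)
      also have "norm (poly_map_value (Q - P) x) \<le> C * coeff_norm (Q - P) * max 1 (norm x) ^ d"
        by (rule C(2)[OF poly_maps_upto_diff[OF Q(1) P]])
      also have "\<dots> \<le> C * coeff_norm (Q - P) * max 1 R ^ d"
        using bnd[OF x] C(1) coeff_norm_nonneg[of "Q - P"]
        by (intro mult_left_mono power_mono) auto
      also have "C * coeff_norm (Q - P) * max 1 R ^ d + norm (q - p) \<le> B * \<delta>"
      proof -
        have "0 \<le> C * max 1 R ^ d * norm (q - p)" using C(1) by simp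
        then show ?thesis using coeff_norm_nonneg[of "Q - P"] by (simp add: B_def \<delta>_def algebra_simps)
      qed
      finally show ?thesis by simp
    qed
    then have approx: "x \<in> approx_SOL K F R (B * \<delta>)"
      using SOL_perturbed_subset_approx_SOL[OF x bnd[OF x]] by blast
    have "\<exists>z\<in>approx_SOL K F R 0. norm (x - z) \<le> L * (B * \<delta>) powr c"
    \<comment> \<open>For delta = 0 the point x itself solves the unperturbed problem; the error bound only covers
      positive tolerances.\<close>
    proof (cases "\<delta> = 0")
      case True
      then show ?thesis using approx by (intro bexI[of _ x]) auto
    next
      case False
      have "\<delta> \<ge> 0" using coeff_norm_nonneg[of "Q - P"] by (simp add: \<delta>_def)
      then have "B * \<delta> > 0" using False B by simp
      have "\<delta> < 2 * \<epsilon>" using Q(3) by (simp add: \<delta>_def)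
      also have "\<dots> \<le> \<tau> / B" using B by (simp add: \<epsilon>_def min_def field_simps)
      finally have "B * \<delta> < \<tau>" using B by (simp add: field_simps)
      with \<open>B * \<delta> > 0\<close> show ?thesis using L(4) approx by blast
    qed
    then obtain z where z: "z \<in> SOL K F" "norm (x - z) \<le> L * (B * \<delta>) powr c"
      unfolding approx_SOL_0 by blast
    define s where "s = L * B powr c * \<delta> powr c"
    have "\<delta> \<ge> 0" using coeff_norm_nonneg[of "Q - P"] by (simp add: \<delta>_def)
    then have s: "norm (x - z) \<le> s" using z(2) B by (simp add: s_def powr_mult)
    have "x = z + s *\<^sub>R ((x - z) /\<^sub>R s)" using s by (cases "s = 0") auto
    moreover have "(x - z) /\<^sub>R s \<in> cball 0 1"
    proof -
      have "s \<ge> 0" using order_trans[OF norm_ge_zero s] .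
      then have "norm ((x - z) /\<^sub>R s) = norm (x - z) / s" by (simp add: divide_inverse mult.commute)
      then show ?thesis using s \<open>s \<ge> 0\<close> by (auto simp: divide_le_eq_1)
    qed
    ultimately show "x \<in> {x + (L * B powr c * (coeff_norm (Q - P) + norm (q - p)) powr c) *\<^sub>R u | x u.
              x \<in> SOL K F \<and> u \<in> cball 0 1}"
      using z(1) unfolding s_def \<delta>_def by blast
  qed
  moreover have "\<epsilon> > 0" using \<epsilon>0 L(3) B by (simp add: \<epsilon>_def)
  moreover have "L * B powr c > 0" using L(1) B by simp
  ultimately show ?thesis using L(2) unfolding F_def by blast
qed

end
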